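(* Let $h\in C^2(\mathbb{R}^n)$ be convex and $\mu>0$. Let $f:\mathbb{R}^n\to\mathbb{R}$, $f(x)=h(x)+\mu\|x\|_1$, and $F:\mathbb{R}^n\times\mathbb{R}^n\to\mathbb{R}$, $F(a,b)=h(a^2-b^2)+\mu\sum_{i=1}^n(a_i^2+b_i^2)$. Let $(a^*,b^* )$ be a second-order stationary point of $F$. Define $s^*=(a^* )^2-(b^* )^2$ and $\Omega=\{x\in\mathbb{R}^n: f(x)=f(s^* )\}$. Let $$J_{3,1}=\{i: s_i^*=0,\ \nabla h(s^* )_i=-\mu\},\quad J_{3,2}=\{i: s_i^*=0,\ \nabla h(s^* )_i=\mu\},\quad J_3=J_{3,1}\cup J_{3,2},$$ $$K=N_{\mu\partial\|s^*\|_1}(-\nabla h(s^* )).$$ Suppose that there exist a neighborhood $V$ of $s^*$ and constants $c>0$, $\gamma\in(0,1]$ such that for all $\rho\in\mathbb{R}_+^{J_3}$, $$\mathrm{dist}(x,\Omega\cap S_\rho)\le c\,\max\{\mathrm{dist}(x,\Omega),\mathrm{dist}(x,S_\rho)\}^\gamma\qquad\forall x\in V\cap(s^*+K),$$ where $S_\rho:=\{x\in\mathbb{R}^n: |x_i-s_i^*|\le\rho_i\ \ \forall i\in J_3\}$. Suppose also that $f$ satisfies the KL property at $s^*$ with exponent $\alpha\in(0,1)$. Then $F$ satisfies the KL property at $(a^*,b^* )$ with exponent $\frac{1+\beta}{2}$, where $\beta=1-\gamma(1-\alpha)\in(0,1)$.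
   Context: For $a\in\mathbb{R}^n$, $a^2$ denotes the componentwise square. A second-order stationary point of $F$ is a point $(a,b)$ with $\nabla F(a,b)=0$ and $\nabla^2F(a,b)\succeq 0$. For such a point (with $h$ convex), $-\nabla h(s^* )\in\mu\,\partial\|s^*\|_1$, so that the set $K$ is well defined; here $\partial\|s\|_1$ is the convex subdifferential of the $\ell_1$-norm at $s$ and $N_C(x)=\{\xi:\langle\xi,y-x\rangle\le 0\ \forall y\in C\}$ is the normal cone of a closed convex set $C$ at $x\in C$. Explicitly, with $J_1=\{i: s_i^*=0,\ \nabla h(s^* )_i\in(-\mu,\mu)\}$ and $J_2=\{i: s_i^*\ne0,\ \nabla h(s^* )_i\in\{-\mu,\mu\}\}$, one has $K=\prod_{i=1}^nK_i$ with $K_i=\{0\}$ for $i\in J_1$, $K_i=\mathbb{R}$ for $i\in J_2$, $K_i=\mathbb{R}_+$ for $i\in J_{3,1}$, $K_i=\mathbb{R}_-$ for $i\in J_{3,2}$. $\mathrm{dist}$ is Euclidean distance. KL property with exponent: for a proper closed function $g:\mathbb{R}^m\to\mathbb{R}\cup\{\infty\}$, $\partial g$ denotes the limiting subdifferential (equal to $\{\nabla g(x)\}$ if $g$ is $C^1$, and to $\nabla g_1+\partial g_2$ if $g=g_1+g_2$ with $g_1\in C^1$ and $g_2$ proper closed convex). The function $g$ satisfies the Kurdyka-Łojasiewicz (KL) property at $\bar x$ (with $\partial g(\bar x)\ne\emptyset$) with exponent $\alpha\in[0,1)$ if there exist $\bar c>0$, $r\in(0,\infty]$ and a neighborhood $V$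 of $\bar x$ such that for every $x\in V$ with $0<g(x)-g(\bar x)<r$ one has $\bar c(1-\alpha)\,(g(x)-g(\bar x))^{-\alpha}\,\mathrm{dist}(0,\partial g(x))\ge 1$, where $\mathrm{dist}(0,\emptyset)=\infty$. *)

theory Defs
  imports "HOL-Analysis.Analysis"
begin

section \<open>Smooth functions\<close>

definition gradient :: "('a::euclidean_space \<Rightarrow> real) \<Rightarrow> 'a \<Rightarrow> 'a" where
  "gradient f x = (THE D. GDERIV f x :> D)"

definition hessian :: "('a::euclidean_space \<Rightarrow> real) \<Rightarrow> 'a \<Rightarrow> 'a \<Rightarrow> 'a" where
  "hessian f x = frechet_derivative (gradient f) (at x)"

definition C2 :: "('a::euclidean_space \<Rightarrow> real) \<Rightarrow> bool" where
  "C2 f \<longleftrightarrow> (\<forall>x. f differentiable (at x)) \<and>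
     (\<exists>H :: 'a \<Rightarrow> ('a \<Rightarrow>\<^sub>L 'a). continuous_on UNIV H \<and>
        (\<forall>x. (gradient f has_derivative blinfun_apply (H x)) (at x)))"

text \<open>Meaningful for \<open>C2\<close> functions, for which \<^const>\<open>gradient\<close> and
  \<^const>\<open>hessian\<close> are the actual derivatives.\<close>

definition second_order_stationary :: "('a::euclidean_space \<Rightarrow> real) \<Rightarrow> 'a \<Rightarrow> bool" where
  "second_order_stationary f x \<longleftrightarrow> gradient f x = 0 \<and> (\<forall>v. 0 \<le> v \<bullet> hessian f x v)"

section \<open>Convex analysis\<close>

definition l1_norm :: "real ^ 'n \<Rightarrow> real" where
  "l1_norm x = (\<Sum>i\<in>UNIV. \<bar>x $ i\<bar>)"

definition vec_square :: "real ^ 'n \<Rightarrow> real ^ 'n" where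
  "vec_square a = (\<chi> i. (a $ i)\<^sup>2)"

definition convex_subdifferential :: "('a::real_inner \<Rightarrow> real) \<Rightarrow> 'a \<Rightarrow> 'a set" where
  "convex_subdifferential f x = {v. \<forall>y. f x + v \<bullet> (y - x) \<le> f y}"

definition normal_cone :: "'a::real_inner set \<Rightarrow> 'a \<Rightarrow> 'a set" where
  "normal_cone C x = {\<xi>. \<forall>y\<in>C. \<xi> \<bullet> (y - x) \<le> 0}"

section \<open>Limiting subdifferential and the Kurdyka-Lojasiewicz property\<close>

definition proper_closed :: "('a::euclidean_space \<Rightarrow> ereal) \<Rightarrow> bool" where
  "proper_closed g \<longleftrightarrow> (\<forall>x. g x \<noteq> -\<infinity>) \<and> (\<exists>x. g x \<noteq> \<infinity>) \<and>
     closed {(x, t :: real). g x \<le> ereal t}"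

definition regular_subdifferential :: "('a::euclidean_space \<Rightarrow> ereal) \<Rightarrow> 'a \<Rightarrow> 'a set" where
  "regular_subdifferential g x = {v. \<bar>g x\<bar> \<noteq> \<infinity> \<and>
     0 \<le> Liminf (at x) (\<lambda>y. (g y - g x - ereal (v \<bullet> (y - x))) / ereal (norm (y - x)))}"

definition limiting_subdifferential :: "('a::euclidean_space \<Rightarrow> ereal) \<Rightarrow> 'a \<Rightarrow> 'a set" where
  "limiting_subdifferential g x = {v. \<bar>g x\<bar> \<noteq> \<infinity> \<and>
     (\<exists>X W. X \<longlonglongrightarrow> x \<and> (\<lambda>k. g (X k)) \<longlonglongrightarrow> g x \<and>
        (\<forall>k. W k \<in> regular_subdifferential g (X k)) \<and> W \<longlonglongrightarrow> v)}"

text \<open>The distance is taken in the extended reals because \<^const>\<open>infdist\<close> and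
  \<^const>\<open>setdist\<close> are \<open>0\<close> on the empty set, whereas here it has to be \<open>\<infinity>\<close>.\<close>

definition dist_zero :: "'a::real_normed_vector set \<Rightarrow> ereal" where
  "dist_zero A = (INF v\<in>A. ereal (norm v))"

definition KL_property ::
    "('a::euclidean_space \<Rightarrow> ereal) \<Rightarrow> 'a \<Rightarrow> real \<Rightarrow> bool" where
  "KL_property g xbar \<alpha> \<longleftrightarrow>
     proper_closed g \<and> limiting_subdifferential g xbar \<noteq> {} \<and> 0 \<le> \<alpha> \<and> \<alpha> < 1 \<and>
     (\<exists>(c::real) (r::ereal) V. 0 < c \<and> 0 < r \<and> xbar \<in> interior V \<and>
        (\<forall>x\<in>V. 0 < g x - g xbar \<and> g x - g xbar < r \<longrightarrow>
           1 \<le> ereal (c * (1 - \<alpha>) * real_of_ereal (g x - g xbar) powr (- \<alpha>))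
                 * dist_zero (limiting_subdifferential g x)))"

end

theory Submission
  imports Defs
begin

text \<open>Write \<open>x = a\<^sup>2 - b\<^sup>2\<close>, \<open>g = \<nabla>h(x)\<close> and \<open>D = \<bar>\<nabla>F(a, b)\<bar>\<close>. Second-order stationarity makes
  \<open>s\<close> a minimizer of \<open>f\<close>, and \<open>F(a, b) = f x + 2\<mu> \<Sum> min (a\<^sub>i\<^sup>2) (b\<^sub>i\<^sup>2)\<close>, where the last sum is
  \<open>O(D\<^sup>2)\<close> because \<open>a\<^sub>i (\<mu> + g\<^sub>i)\<close> and \<open>b\<^sub>i (\<mu> - g\<^sub>i)\<close> are \<open>O(D)\<close> and the two factors cannot both be
  small. Truncating \<open>x\<close> to a point \<open>y\<close> of \<open>s + K\<close> costs only \<open>O(D\<^sup>2)\<close>. The KL property of \<open>f\<close>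
  bounds the distance of \<open>y\<close> to the solution set \<open>\<Omega>\<close> by a power of \<open>f y - f s\<close>, and the error bound
  with \<open>\<rho>\<^sub>i = \<bar>y\<^sub>i\<bar>\<close> yields \<open>p \<in> \<Omega>\<close> with \<open>\<bar>p\<^sub>i\<bar> \<le> \<bar>y\<^sub>i\<bar>\<close> on \<open>J\<^sub>3\<close> and
  \<open>\<bar>y - p\<bar> = O((f y - f s) powr (1 - \<beta>))\<close>. In the convexity bound for \<open>f x - f p\<close> a coordinate in
  \<open>J\<^sub>3\<close> contributes about \<open>\<bar>\<mu> + g\<^sub>i\<bar> * \<bar>x\<^sub>i - p\<^sub>i\<bar> \<le> (\<bar>\<mu> + g\<^sub>i\<bar> * \<bar>a\<^sub>i\<bar>) * \<bar>y - p\<bar> powr (1/2)\<close>, since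
  \<open>\<bar>x\<^sub>i - p\<^sub>i\<bar> \<le> a\<^sub>i\<^sup>2\<close>. Hence the gap \<open>T\<close> of \<open>F\<close> is \<open>O(D * T powr ((1 - \<beta>)/2) + D\<^sup>2)\<close>.\<close>

section \<open>Gradients\<close>

lemma GDERIV_unique:
  assumes "GDERIV f x :> D" "GDERIV f x :> E"
  shows "D = E"
proof -
  have "(\<lambda>h. h \<bullet> D) = (\<lambda>h. h \<bullet> E)"
    using assms unfolding gderiv_def by (rule has_derivative_unique)
  then show ?thesis
    by (metis inner_commute vector_eq_rdot)
qed

lemma gradient_eqI: "GDERIV f x :> D \<Longrightarrow> gradient f x = D"
  unfolding gradient_def by (blast intro: GDERIV_unique)

text \<open>The values of the derivative on the basis are the coordinates of the gradient vector.
  This makes the description in \<open>gradient\<close> denote an actual derivative.\<close>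

lemma GDERIV_gradient:
  fixes f :: "'a::euclidean_space \<Rightarrow> real"
  assumes "f differentiable (at x)"
  shows "GDERIV f x :> gradient f x"
proof -
  obtain f' where f': "(f has_derivative f') (at x)"
    using assms by (auto simp: differentiable_def)
  then interpret bounded_linear f'
    by (rule has_derivative_bounded_linear)
  have "f' v = v \<bullet> (\<Sum>e\<in>Basis. f' e *\<^sub>R e)" for v
  proof -
    have "f' v = f' (\<Sum>e\<in>Basis. (v \<bullet> e) *\<^sub>R e)"
      by (simp add: euclidean_representation)
    also have "\<dots> = v \<bullet> (\<Sum>e\<in>Basis. f' e *\<^sub>R e)"
      by (simp add: sum scaleR inner_sum_right mult.commute)
    finally show ?thesis .
  qed
  then have "f' = (\<lambda>v. v \<bullet> (\<Sum>e\<in>Basis. f' e *\<^sub>R e))"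
    by (rule ext)
  with f' have "GDERIV f x :> (\<Sum>e\<in>Basis. f' e *\<^sub>R e)"
    by (simp add: gderiv_def)
  then show ?thesis
    using gradient_eqI by metis
qed

lemma C2_GDERIV: "C2 f \<Longrightarrow> GDERIV f x :> gradient f x"
  by (simp add: C2_def GDERIV_gradient)

lemma C2_gradient_differentiable: "C2 f \<Longrightarrow> gradient f differentiable (at x)"
  unfolding C2_def differentiable_def by blast

lemma has_derivative_vecI:
  fixes f :: "'a::real_normed_vector \<Rightarrow> real ^ 'n"
  assumes "\<And>i. ((\<lambda>x. f x $ i) has_derivative (\<lambda>h. f' h $ i)) (at x within S)"
  shows "(f has_derivative f') (at x within S)"
  using assms by (subst has_derivative_componentwise_within)
    (auto simp: Basis_vec_def inner_axis)

text \<open>Restriction to the line through \<open>x\<close> and \<open>y\<close> reduces the claim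
  to the tangent inequality in one real variable.\<close>

lemma convex_on_gradient_le:
  fixes h :: "'a::real_inner \<Rightarrow> real"
  assumes "convex_on UNIV h" and D: "GDERIV h x :> D"
  shows "h x + D \<bullet> (y - x) \<le> h y"
proof -
  let ?g = "\<lambda>t::real. h (x + t *\<^sub>R (y - x))"
  have "convex_on UNIV ?g"
  proof (rule convex_onI)
    fix t u v :: real
    assume t: "0 < t" "t < 1"
    have "x + ((1 - t) *\<^sub>R u + t *\<^sub>R v) *\<^sub>R (y - x)
        = (1 - t) *\<^sub>R (x + u *\<^sub>R (y - x)) + t *\<^sub>R (x + v *\<^sub>R (y - x))"
      by (simp add: algebra_simps)
    then show "?g ((1 - t) *\<^sub>R u + t *\<^sub>R v) \<le> (1 - t) * ?g u + t * ?g v"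
      using convex_onD[OF assms(1), of t "x + u *\<^sub>R (y - x)" "x + v *\<^sub>R (y - x)"] t by simp
  qed auto
  moreover have "(?g has_real_derivative D \<bullet> (y - x)) (at 0)"
  proof -
    have "((\<lambda>t::real. x + t *\<^sub>R (y - x)) has_derivative (\<lambda>t. t *\<^sub>R (y - x))) (at 0)"
      by (auto intro!: derivative_eq_intros)
    moreover have "(h has_derivative (\<lambda>v. v \<bullet> D)) (at (x + 0 *\<^sub>R (y - x)))"
      using D by (simp add: gderiv_def)
    ultimately have "(?g has_derivative (\<lambda>t. (t *\<^sub>R (y - x)) \<bullet> D)) (at 0)"
      by (rule has_derivative_compose)
    then show ?thesis
      by (rule has_derivative_imp_has_field_derivative) (simp add: inner_commute)
  qed
  ultimately have "?g 1 - ?g 0 \<ge> (D \<bullet> (y - x)) * (1 - 0)"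
    by (intro convex_on_imp_above_tangent[of UNIV]) auto
  then show ?thesis by simp
qed

section \<open>Subdifferentials of real-valued functions\<close>

text \<open>Clears the extended-real quotient once and for all, so that membership can be both
  tested and established by a real inequality with an \<open>e\<close>-error.\<close>

lemma regular_subdifferential_real_iff:
  fixes f :: "'a::euclidean_space \<Rightarrow> real"
  shows "v \<in> regular_subdifferential (\<lambda>x. ereal (f x)) x \<longleftrightarrow>
    (\<forall>e>0. \<forall>\<^sub>F y in at x. f y - f x - v \<bullet> (y - x) \<ge> - e * norm (y - x))"
proof -
  let ?q = "\<lambda>y. (f y - f x - v \<bullet> (y - x)) / norm (y - x)"
  have ev: "(\<forall>\<^sub>F y in at x. - e \<le> ?q y)
      \<longleftrightarrow> (\<forall>\<^sub>F y in at x. f y - f x - v \<bullet> (y - x) \<ge> - e * norm (y - x))" for e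
  proof (rule eventually_cong)
    show "\<forall>\<^sub>F y in at x. y \<noteq> x"
      by (simp add: eventually_at_filter)
  qed (simp add: pos_le_divide_eq)
  have eq: "(ereal (f y) - ereal (f x) - ereal (v \<bullet> (y - x))) / ereal (norm (y - x)) = ereal (?q y)"
    if "y \<noteq> x" for y
    using that by simp
  have "v \<in> regular_subdifferential (\<lambda>x. ereal (f x)) x
      \<longleftrightarrow> (\<forall>u<0. \<forall>\<^sub>F y in at x. u < (ereal (f y) - ereal (f x) - ereal (v \<bullet> (y - x))) / ereal (norm (y - x)))"
    by (simp add: regular_subdifferential_def le_Liminf_iff)
  also have "\<dots> \<longleftrightarrow> (\<forall>u<0. \<forall>\<^sub>F y in at x. u < ereal (?q y))"
    by (intro all_cong imp_cong refl eventually_cong[OF eventually_at_filter[THEN iffD2]])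
      (auto simp: eq)
  also have "\<dots> \<longleftrightarrow> (\<forall>e>0. \<forall>\<^sub>F y in at x. - e \<le> ?q y)"
  proof safe
    fix e :: real
    assume "\<forall>u<0. \<forall>\<^sub>F y in at x. u < ereal (?q y)" "0 < e"
    then have "\<forall>\<^sub>F y in at x. ereal (- e) < ereal (?q y)"
      by (auto dest!: spec[of _ "ereal (- e)"])
    then show "\<forall>\<^sub>F y in at x. - e \<le> ?q y"
      by eventually_elim simp
  next
    fix u :: ereal
    assume e: "\<forall>e>0. \<forall>\<^sub>F y in at x. - e \<le> ?q y" and "u < 0"
    then obtain w where w: "u < ereal w" "ereal w < 0"
      using ereal_dense2 by blast
    then have "\<forall>\<^sub>F y in at x. - (- w) \<le> ?q y"
      using e[rule_format, of "- w"] by simp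
    then show "\<forall>\<^sub>F y in at x. u < ereal (?q y)"
    proof eventually_elim
      case (elim y)
      then have "ereal w \<le> ereal (?q y)" by simp
      with w(1) show ?case by (rule less_le_trans)
    qed
  qed
  finally show ?thesis using ev by simp
qed

lemma regular_subdifferential_subset_limiting:
  "regular_subdifferential g x \<subseteq> limiting_subdifferential g x"
  unfolding limiting_subdifferential_def
  by (auto simp: regular_subdifferential_def
      intro!: exI[of _ "\<lambda>_. x"] exI[of _ "\<lambda>_. _"])

lemma regular_subdifferential_GDERIV:
  fixes f :: "'a::euclidean_space \<Rightarrow> real"
  assumes D: "GDERIV f x :> D"
  shows "regular_subdifferential (\<lambda>x. ereal (f x)) x = {D}"
proof -
  have small: "\<forall>\<^sub>F y in at x. \<bar>f y - f x - D \<bullet> (y - x)\<bar> \<le> e * norm (y - x)" if "0 < e" for e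
  proof -
    from D that obtain d where "d > 0"
      and d: "\<And>y. norm (y - x) < d \<Longrightarrow> \<bar>f y - f x - (y - x) \<bullet> D\<bar> \<le> e * norm (y - x)"
      unfolding gderiv_def has_derivative_at_alt by (auto simp: real_norm_def)
    then show ?thesis
      by (auto simp: eventually_at dist_norm inner_commute)
  qed
  have "D \<in> regular_subdifferential (\<lambda>x. ereal (f x)) x"
    unfolding regular_subdifferential_real_iff
    using small by (fastforce elim: eventually_mono)
  moreover have "v = D" if v: "v \<in> regular_subdifferential (\<lambda>x. ereal (f x)) x" for v
  proof (rule ccontr)
    assume "v \<noteq> D"
    \<comment> \<open>With a third of the distance, both error terms together reach only 2/3 of
      \<open>norm (v - D) * norm (y - x)\<close>, whereas a step along \<open>v - D\<close> attains
      the full product.\<close>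
    define e where "e = norm (v - D) / 3"
    have "e > 0" using \<open>v \<noteq> D\<close> by (simp add: e_def)
    have "\<forall>\<^sub>F y in at x. f y - f x - v \<bullet> (y - x) \<ge> - e * norm (y - x)"
      using v \<open>e > 0\<close> by (simp add: regular_subdifferential_real_iff)
    with small[OF \<open>e > 0\<close>]
    have "\<forall>\<^sub>F y in at x. (v - D) \<bullet> (y - x) \<le> 2 * e * norm (y - x)"
      by eventually_elim (simp add: inner_diff_left)
    then obtain d where "d > 0"
      and d: "\<And>y. y \<noteq> x \<Longrightarrow> dist y x < d \<Longrightarrow> (v - D) \<bullet> (y - x) \<le> 2 * e * norm (y - x)"
      by (auto simp: eventually_at)
    define t where "t = d / (2 * norm (v - D))"
    have "t > 0" using \<open>d > 0\<close> \<open>v \<noteq> D\<close> by (simp add: t_def)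
    have "dist (x + t *\<^sub>R (v - D)) x < d"
      using \<open>d > 0\<close> \<open>v \<noteq> D\<close> by (simp add: dist_norm t_def)
    then have "(v - D) \<bullet> (t *\<^sub>R (v - D)) \<le> 2 * e * norm (t *\<^sub>R (v - D))"
      using d[of "x + t *\<^sub>R (v - D)"] \<open>t > 0\<close> \<open>v \<noteq> D\<close> by simp
    then have "t * (norm (v - D))\<^sup>2 \<le> t * (2 / 3 * (norm (v - D))\<^sup>2)"
      using \<open>t > 0\<close> by (simp add: e_def power2_norm_eq_inner[symmetric] power2_eq_square)
    then show False
      using \<open>t > 0\<close> \<open>v \<noteq> D\<close> by simp
  qed
  ultimately show ?thesis by blast
qed

text \<open>Regular subgradients at the approximating points are gradients there, and continuity of
  \<open>D\<close> carries them to the limit.\<close>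

lemma limiting_subdifferential_C1:
  fixes f :: "'a::euclidean_space \<Rightarrow> real"
  assumes D: "\<And>x. GDERIV f x :> D x" and "isCont D x"
  shows "limiting_subdifferential (\<lambda>x. ereal (f x)) x = {D x}"
proof -
  have "v = D x" if "v \<in> limiting_subdifferential (\<lambda>x. ereal (f x)) x" for v
  proof -
    from that obtain X W where X: "X \<longlonglongrightarrow> x"
      and W: "\<And>k. W k \<in> regular_subdifferential (\<lambda>x. ereal (f x)) (X k)" "W \<longlonglongrightarrow> v"
      by (auto simp: limiting_subdifferential_def)
    have "W = (\<lambda>k. D (X k))"
      using W(1) by (simp add: regular_subdifferential_GDERIV[OF D] fun_eq_iff)
    moreover have "(\<lambda>k. D (X k)) \<longlonglongrightarrow> D x"
      using assms(2) X by (rule isCont_tendsto_compose)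
    ultimately show ?thesis
      using W(2) LIMSEQ_unique by blast
  qed
  then show ?thesis
    using regular_subdifferential_subset_limiting[of "\<lambda>x. ereal (f x)" x]
      regular_subdifferential_GDERIV[OF D, of x] by blast
qed

lemma proper_closed_continuous:
  fixes f :: "'a::euclidean_space \<Rightarrow> real"
  assumes "continuous_on UNIV f"
  shows "proper_closed (\<lambda>x. ereal (f x))"
proof -
  have "closed {p :: 'a \<times> real. f (fst p) \<le> snd p}"
    by (intro closed_Collect_le continuous_on_compose2[OF assms] continuous_intros) auto
  then show ?thesis
    by (simp add: proper_closed_def case_prod_unfold)
qed

section \<open>Subgradients of the l1-norm by coordinates, and two auxiliary facts\<close>

lemma convex_subdifferential_l1_norm:
  assumes "v \<in> convex_subdifferential l1_norm s"
  shows "v $ i * d \<le> \<bar>s $ i + d\<bar> - \<bar>s $ i\<bar>"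
proof -
  have "l1_norm (s + axis i d) = l1_norm s - \<bar>s $ i\<bar> + \<bar>s $ i + d\<bar>"
    unfolding l1_norm_def
    by (subst (1 2) sum.remove[of UNIV i]) (auto simp: axis_def intro!: sum.cong)
  moreover have "l1_norm s + v \<bullet> axis i d \<le> l1_norm (s + axis i d)"
    using assms by (auto simp: convex_subdifferential_def dest!: spec[of _ "s + axis i d"])
  ultimately show ?thesis
    by (simp add: inner_axis)
qed

lemma eventually_nhds_isCont_dist:
  assumes "isCont f x" "0 < e"
  shows "\<forall>\<^sub>F y in nhds x. dist (f y) (f x) < e"
  using assms tendstoD unfolding isCont_def tendsto_at_iff_tendsto_nhds by blast

text \<open>Supplies one gap for finitely many coordinates. The factor 2 leaves a margin of
  \<open>\<eta>\<close> after a perturbation of size \<open>\<eta>\<close>.\<close>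

lemma finite_positive_lower_bound:
  fixes A :: "real set"
  assumes "finite A"
  obtains \<eta> where "0 < \<eta>" "\<And>x. x \<in> A \<Longrightarrow> 0 < x \<Longrightarrow> 2 * \<eta> \<le> x"
proof
  \<comment> \<open>The inserted 1 keeps the minimum meaningful when \<open>A\<close> has no
    positive element.\<close>
  let ?B = "insert 1 {x \<in> A. 0 < x}"
  have "finite ?B" using assms by simp
  then show "0 < Min ?B / 2" by (auto simp: Min_gr_iff)
  show "2 * (Min ?B / 2) \<le> x" if "x \<in> A" "0 < x" for x
    using that \<open>finite ?B\<close> by (auto intro!: Min_le simp del: Min_insert)
qed

section \<open>From the KL property to an error bound\<close>

text \<open>Concavity of \<open>powr\<close>: for positive \<open>u\<close> the tangent inequality
  at \<open>w\<close> is Young's inequality multiplied by \<open>w powr (p - 1)\<close>.\<close>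

lemma powr_le_tangent:
  fixes p u w :: real
  assumes "0 < p" "p \<le> 1" "0 \<le> u" "0 < w"
  shows "u powr p \<le> w powr p + p * w powr (p - 1) * (u - w)"
proof (cases "u = 0")
  case True
  have "p * w powr (p - 1) * w = p * w powr p"
    using \<open>0 < w\<close> by (simp add: powr_diff)
  also have "\<dots> \<le> w powr p"
    using mult_right_mono[OF \<open>p \<le> 1\<close>, of "w powr p"] by simp
  finally show ?thesis
    using True by simp
next
  case False
  have "u powr p = (u powr p * w powr (1 - p)) * w powr (p - 1)"
    using \<open>0 < w\<close> by (simp add: powr_diff)
  also have "\<dots> \<le> (p * u + (1 - p) * w) * w powr (p - 1)"
    using Youngs_inequality_0[of p "1 - p" u w] assms False
    by (intro mult_right_mono) auto
  also have "\<dots> = w powr p + p * w powr (p - 1) * (u - w)"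
    using \<open>0 < w\<close> by (simp add: powr_diff field_simps)
  finally show ?thesis .
qed

text \<open>A minimizer \<open>y\<close> of the desingularized function \<open>(f z - f s) powr (1 - \<alpha>)\<close>
  plus a small quadratic penalty \<open>k * \<bar>z - x\<bar>\<^sup>2\<close> must lie in the solution set: otherwise
  concavity of \<open>powr\<close> turns the gradient of the penalty into a subgradient of \<open>f\<close> at \<open>y\<close>
  that is too short for the KL inequality.\<close>

lemma KL_property_imp_error_bound:
  fixes f :: "'a::euclidean_space \<Rightarrow> real"
  assumes cont: "continuous_on UNIV f" and min: "\<And>x. f s \<le> f x"
    and KL: "KL_property (\<lambda>x. ereal (f x)) s \<alpha>"
  obtains C d where "0 < C" "0 < d"
    "\<And>x. x \<in> ball s d \<Longrightarrow> infdist x {y. f y = f s} \<le> C * (f x - f s) powr (1 - \<alpha>)"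
proof -
  define p where "p = 1 - \<alpha>"
  define \<phi> where "\<phi> x = (f x - f s) powr p" for x
  have p: "0 < p" "p \<le> 1" and \<alpha>: "\<alpha> = 1 - p"
    using KL by (auto simp: KL_property_def p_def)
  have cont': "isCont f x" for x
    using cont by (simp add: continuous_on_eq_continuous_at)
  have cont_\<phi>: "continuous_on UNIV \<phi>"
    unfolding \<phi>_def
    by (intro continuous_on_powr' continuous_intros cont) (use min p in auto)
  obtain c r V where c: "0 < c" and r: "0 < (r :: ereal)" and V: "s \<in> interior V"
    and KLV: "\<And>x. x \<in> V \<Longrightarrow> 0 < ereal (f x) - ereal (f s) \<Longrightarrow> ereal (f x) - ereal (f s) < r \<Longrightarrow>
        1 \<le> ereal (c * p * real_of_ereal (ereal (f x) - ereal (f s)) powr (p - 1))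
          * dist_zero (limiting_subdifferential (\<lambda>x. ereal (f x)) x)"
    using KL unfolding KL_property_def \<alpha> by auto
  \<comment> \<open>\<open>r\<close> may be infinite; a real level below it can be enforced near
    \<open>s\<close> by continuity of \<open>f\<close>.\<close>
  obtain r' where r': "0 < r'" "ereal r' < r"
    using ereal_dense2[OF r] by auto
  have "\<forall>\<^sub>F x in nhds s. x \<in> V"
    using V by (auto simp: eventually_nhds interior_def)
  moreover have "\<forall>\<^sub>F x in nhds s. f x < f s + r'"
    using order_tendstoD(2)[OF cont'[of s, unfolded isCont_def tendsto_at_iff_tendsto_nhds], of "f s + r'"] r'
    by simp
  ultimately have "\<forall>\<^sub>F x in nhds s. x \<in> V \<and> f x < f s + r'"
    by (rule eventually_conj)
  then obtain \<epsilon> where \<epsilon>: "0 < \<epsilon>" and near: "\<And>x. dist x s < \<epsilon> \<Longrightarrow> x \<in> V \<and> f x < f s + r'"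
    by (auto simp: eventually_nhds_metric)
  have "isCont \<phi> s"
    using cont_\<phi> by (simp add: continuous_on_eq_continuous_at)
  \<comment> \<open>This threshold makes the later bound \<open>3 * c * \<phi> x\<close> on the
    displacement smaller than \<open>\<epsilon> / 2\<close>, so the penalized minimizer is interior
    to the ball.\<close>
  moreover have "\<phi> s < \<epsilon> / (6 * c)"
    using \<epsilon> c by (simp add: \<phi>_def)
  ultimately have "\<forall>\<^sub>F x in nhds s. \<phi> x < \<epsilon> / (6 * c)"
    by (auto simp: order_tendstoD tendsto_at_iff_tendsto_nhds isCont_def)
  then obtain d where d: "0 < d" and \<phi>d: "\<And>x. dist x s < d \<Longrightarrow> \<phi> x < \<epsilon> / (6 * c)"
    by (auto simp: eventually_nhds_metric)

  have step: "infdist x {y. f y = f s} \<le> 3 * c * \<phi> x" if x: "x \<in> ball s (min d (\<epsilon> / 2))" for x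
  proof (cases "f x = f s")
    case True
    then have "x \<in> {y. f y = f s}" by simp
    then show ?thesis using True by (simp add: \<phi>_def)
  next
    case False
    then have "0 < \<phi> x"
      using min[of x] by (simp add: \<phi>_def)
    \<comment> \<open>The weight balances two demands: comparing \<open>y\<close> with
      \<open>x\<close> gives \<open>norm (y - x)^2 <= \<phi> x / k = 8 c^2 (\<phi> x)^2\<close>,
      hence radius \<open>3 c \<phi> x\<close>, and then
      \<open>(2 k c norm (y - x))^2 <= 1/2\<close>, which contradicts the KL lower bound 1.\<close>
    define k where "k = 1 / (8 * c\<^sup>2 * \<phi> x)"
    have "0 < k" using \<open>0 < \<phi> x\<close> c by (simp add: k_def)
    obtain y where y: "y \<in> cball x (\<epsilon> / 2)"
      and ymin: "\<And>z. z \<in> cball x (\<epsilon> / 2) \<Longrightarrow> \<phi> y + k * (norm (y - x))\<^sup>2 \<le> \<phi> z + k * (norm (z - x))\<^sup>2"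
    proof -
      have "continuous_on (cball x (\<epsilon> / 2)) (\<lambda>z. \<phi> z + k * (norm (z - x))\<^sup>2)"
        by (intro continuous_intros continuous_on_subset[OF cont_\<phi>]) auto
      then show ?thesis
        using continuous_attains_inf[OF compact_cball, of x "\<epsilon> / 2"] \<epsilon> that by fastforce
    qed
    have "\<phi> y + k * (norm (y - x))\<^sup>2 \<le> \<phi> x"
      using ymin[of x] \<epsilon> by simp
    moreover have "0 \<le> \<phi> y" by (simp add: \<phi>_def)
    ultimately have "k * (norm (y - x))\<^sup>2 \<le> \<phi> x" by linarith
    then have sq: "(norm (y - x))\<^sup>2 \<le> 8 * c\<^sup>2 * (\<phi> x)\<^sup>2"
      using \<open>0 < \<phi> x\<close> c by (simp add: k_def field_simps power2_eq_square)
    also have "\<dots> \<le> (3 * c * \<phi> x)\<^sup>2"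
      by (simp add: power_mult_distrib mult_right_mono)
    finally have yx: "norm (y - x) \<le> 3 * c * \<phi> x"
      by (rule power2_le_imp_le) (use \<open>0 < \<phi> x\<close> c in simp)
    have "\<phi> x < \<epsilon> / (6 * c)"
      using \<phi>d x by (simp add: dist_commute)
    then have yx2: "norm (y - x) < \<epsilon> / 2"
      using yx c by (simp add: field_simps)
    have "dist y s < \<epsilon>"
      using yx2 x dist_triangle[of y s x] by (simp add: dist_norm norm_minus_commute)
    have "f y = f s"
    proof (rule ccontr)
      assume "f y \<noteq> f s"
      define w where "w = f y - f s"
      \<comment> \<open>\<open>m\<close> is the slope of the tangent to \<open>powr\<close> at
        \<open>w\<close>; \<open>v\<close> is the negative penalty gradient rescaled by it.\<close>
      define m where "m = p * w powr (p - 1)"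
      define v where "v = - ((2 * k / m) *\<^sub>R (y - x))"
      have "0 < w" using min[of y] \<open>f y \<noteq> f s\<close> by (simp add: w_def)
      then have "0 < m" using p by (simp add: m_def)
      have "v \<in> regular_subdifferential (\<lambda>x. ereal (f x)) y"
        unfolding regular_subdifferential_real_iff
      proof safe
        fix e :: real assume "0 < e"
        \<comment> \<open>The first entry keeps \<open>z\<close> in the ball where \<open>y\<close>
          is minimal; the second lets \<open>e * norm (z - y)\<close> absorb the quadratic remainder
          of the penalty.\<close>
        define q where "q = min (\<epsilon> / 2 - norm (y - x)) (e * m / k)"
        have "0 < q" using yx2 \<open>0 < e\<close> \<open>0 < m\<close> \<open>0 < k\<close> by (simp add: q_def)
        have "- e * norm (z - y) \<le> f z - f y - v \<bullet> (z - y)" if z: "dist z y < q" for z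
        proof -
          have "norm (z - x) \<le> norm (z - y) + norm (y - x)"
            using norm_triangle_ineq[of "z - y" "y - x"] by simp
          then have "z \<in> cball x (\<epsilon> / 2)"
            using z by (simp add: q_def dist_norm norm_minus_commute)
          then have "\<phi> y + k * (norm (y - x))\<^sup>2 \<le> \<phi> z + k * (norm (z - x))\<^sup>2"
            by (rule ymin)
          moreover have "\<phi> z \<le> \<phi> y + m * (f z - f y)"
            using powr_le_tangent[OF p, of "f z - f s" w] min[of z] \<open>0 < w\<close>
            by (simp add: \<phi>_def m_def w_def)
          moreover have "(norm (z - x))\<^sup>2 = (norm (y - x))\<^sup>2 + 2 * ((y - x) \<bullet> (z - y)) + (norm (z - y))\<^sup>2"
            using dot_norm[of "y - x" "z - y"] by simp
          ultimately have "0 \<le> m * (f z - f y) + k * (2 * ((y - x) \<bullet> (z - y)) + (norm (z - y))\<^sup>2)"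
            by (simp add: algebra_simps)
          moreover have "m * (v \<bullet> (z - y)) = - 2 * k * ((y - x) \<bullet> (z - y))"
            using \<open>0 < m\<close> by (simp add: v_def)
          moreover have "k * (norm (z - y))\<^sup>2 \<le> m * (e * norm (z - y))"
          proof -
            have "k * norm (z - y) \<le> m * e"
              using z \<open>0 < k\<close> by (simp add: q_def dist_norm field_simps)
            then show ?thesis
              using mult_right_mono[of _ _ "norm (z - y)"] by (fastforce simp: power2_eq_square mult.assoc)
          qed
          ultimately have "0 \<le> m * (f z - f y - v \<bullet> (z - y) + e * norm (z - y))"
            by (simp add: algebra_simps)
          then show ?thesis
            using \<open>0 < m\<close> by (simp add: zero_le_mult_iff)
        qed
        then show "\<forall>\<^sub>F z in at y. - e * norm (z - y) \<le> f z - f y - v \<bullet> (z - y)"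
          using \<open>0 < q\<close> by (auto simp: eventually_at)
      qed
      then have "v \<in> limiting_subdifferential (\<lambda>x. ereal (f x)) y"
        using regular_subdifferential_subset_limiting by blast
      then have "dist_zero (limiting_subdifferential (\<lambda>x. ereal (f x)) y) \<le> ereal (norm v)"
        unfolding dist_zero_def by (rule INF_lower)
      moreover have "1 \<le> ereal (c * p * real_of_ereal (ereal (f y) - ereal (f s)) powr (p - 1))
          * dist_zero (limiting_subdifferential (\<lambda>x. ereal (f x)) y)"
      proof (rule KLV)
        show "y \<in> V" using near \<open>dist y s < \<epsilon>\<close> by blast
        show "0 < ereal (f y) - ereal (f s)" using \<open>0 < w\<close> by (simp add: w_def)
        have "ereal (f y) - ereal (f s) < ereal r'"
          using near[OF \<open>dist y s < \<epsilon>\<close>] by simp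
        also note r'(2)
        finally show "ereal (f y) - ereal (f s) < r" .
      qed
      moreover have "ereal (c * p * real_of_ereal (ereal (f y) - ereal (f s)) powr (p - 1)) = ereal (c * m)"
        by (simp add: m_def w_def)
      ultimately have "1 \<le> ereal (c * m) * ereal (norm v)"
        using c \<open>0 < m\<close> by (metis ereal_less_eq(5) ereal_mult_left_mono less_eq_real_def mult_nonneg_nonneg order_trans)
      then have "1 \<le> c * m * norm v"
        by simp
      also have "\<dots> = 2 * k * c * norm (y - x)"
        using \<open>0 < m\<close> \<open>0 < k\<close> by (simp add: v_def)
      finally have "1\<^sup>2 \<le> (2 * k * c * norm (y - x))\<^sup>2"
        by (intro power_mono) auto
      also have "\<dots> = 4 * k\<^sup>2 * c\<^sup>2 * (norm (y - x))\<^sup>2"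
        by (simp add: power_mult_distrib)
      also have "\<dots> \<le> 4 * k\<^sup>2 * c\<^sup>2 * (8 * c\<^sup>2 * (\<phi> x)\<^sup>2)"
        using sq by (intro mult_left_mono) auto
      also have "\<dots> = 1 / 2"
        using c \<open>0 < \<phi> x\<close> by (simp add: k_def power2_eq_square)
      finally show False by simp
    qed
    then have "infdist x {y. f y = f s} \<le> dist x y"
      by (intro infdist_le) simp
    then show ?thesis
      using yx by (simp add: dist_norm norm_minus_commute)
  qed
  show ?thesis
    by (rule that[of "3 * c" "min d (\<epsilon> / 2)"]) (use c d \<epsilon> step in \<open>auto simp: \<phi>_def p_def\<close>)
qed

text \<open>If \<open>T <= D^2\<close>, the exponent is at least 1/2 and \<open>T <= 1\<close>, so
  the left side is at most \<open>sqrt T <= D\<close>. Otherwise \<open>D^2\<close> is absorbed: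
  \<open>t <= (1 + M) T\<close> and \<open>D <= T powr q\<close> with
  \<open>q = (1 - \<beta>) / 2 <= 1/2\<close>, and dividing by \<open>T powr q\<close> leaves the
  power \<open>1 - q = (1 + \<beta>) / 2\<close>.\<close>

lemma powr_le_of_gap_bound:
  fixes D M T t \<beta> :: real
  assumes "0 \<le> D" "0 \<le> M" "0 < T" "T \<le> 1" "0 \<le> t" "0 \<le> \<beta>" "\<beta> \<le> 1"
    and t: "t \<le> T + M * D\<^sup>2"
    and T: "T \<le> M * D * t powr ((1 - \<beta>) / 2) + M * D\<^sup>2"
  shows "T powr ((1 + \<beta>) / 2) \<le> (1 + M + M * (1 + M) powr ((1 - \<beta>) / 2)) * D"
proof (cases "T \<le> D\<^sup>2")
  case True
  have "T powr ((1 + \<beta>) / 2) \<le> T powr (1 / 2)"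
    using assms by (intro powr_mono') auto
  also have "\<dots> = sqrt T"
    using \<open>0 < T\<close> by (simp add: powr_half_sqrt)
  also have "\<dots> \<le> 1 * D"
    using True \<open>0 \<le> D\<close> by (simp add: real_le_lsqrt)
  also have "\<dots> \<le> (1 + M + M * (1 + M) powr ((1 - \<beta>) / 2)) * D"
    using assms by (intro mult_right_mono) auto
  finally show ?thesis .
next
  case False
  define q where "q = (1 - \<beta>) / 2"
  have q: "0 \<le> q" "q \<le> 1 / 2" "(1 + \<beta>) / 2 = 1 - q"
    using assms by (auto simp: q_def field_simps)
  have "M * D\<^sup>2 \<le> M * T"
    using False \<open>0 \<le> M\<close> by (intro mult_left_mono) auto
  with t have "t \<le> (1 + M) * T"
    by (simp add: algebra_simps)
  then have "t powr q \<le> ((1 + M) * T) powr q"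
    using q assms by (intro powr_mono2) auto
  also have "\<dots> = (1 + M) powr q * T powr q"
    using assms by (simp add: powr_mult)
  finally have tq: "t powr q \<le> (1 + M) powr q * T powr q" .
  have "D \<le> sqrt T"
    using False by (simp add: real_le_rsqrt)
  also have "\<dots> \<le> T powr q"
    using powr_mono'[of q "1 / 2" T] q assms by (simp add: powr_half_sqrt)
  finally have Dq: "D \<le> T powr q" .
  have "T \<le> M * D * ((1 + M) powr q * T powr q) + M * D * T powr q"
  proof -
    have "M * D * t powr q \<le> M * D * ((1 + M) powr q * T powr q)"
      using tq assms by (intro mult_left_mono) auto
    moreover have "M * D\<^sup>2 \<le> M * D * T powr q"
      using Dq assms by (simp add: power2_eq_square mult.assoc mult_left_mono)
    ultimately show ?thesis
      using T by (simp add: q_def)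
  qed
  also have "\<dots> = (M + M * (1 + M) powr q) * D * T powr q"
    by (simp add: algebra_simps)
  finally have "T powr (1 - q) \<le> (M + M * (1 + M) powr q) * D"
    using \<open>0 < T\<close> by (simp add: powr_diff field_simps)
  also have "\<dots> \<le> (1 + M + M * (1 + M) powr q) * D"
    using assms by (intro mult_right_mono) auto
  finally show ?thesis
    by (simp add: q q_def)
qed

section \<open>Coordinatewise estimates\<close>

text \<open>One coordinate of the projection onto \<open>s + K\<close>; \<open>g\<close> stands for the partial derivative of \<open>h\<close> at the stationary point.\<close>

definition cone_clip :: "real \<Rightarrow> real \<Rightarrow> real \<Rightarrow> real \<Rightarrow> real" where
  "cone_clip \<mu> g s x = (if s \<noteq> 0 then x else if g = - \<mu> then max x 0
      else if g = \<mu> then min x 0 else 0)"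

text \<open>One coordinate of the whole situation: \<open>g\<close> is the partial derivative of
  \<open>h\<close> at the current point \<open>x\<close>, \<open>g'\<close> the one at the
  stationary point \<open>s\<close>, \<open>D\<close> bounds the gradient of the lifted objective,
  and \<open>p\<close> is to be a coordinate of a solution. The gap \<open>\<eta>\<close> ensures
  that strict inequalities at \<open>s\<close> survive at \<open>x\<close>.\<close>

context
  fixes a b g g' s x p \<mu> \<eta> D :: real
  assumes \<eta>: "0 < \<eta>" "\<eta> \<le> \<mu>" and x: "x = a\<^sup>2 - b\<^sup>2"
    and near: "\<bar>g - g'\<bar> \<le> \<eta>" "\<bar>x - s\<bar> \<le> \<eta>"
    and crit: "\<bar>g'\<bar> \<le> \<mu>" "g' * s + \<mu> * \<bar>s\<bar> = 0"
    and gap: "g' \<noteq> - \<mu> \<Longrightarrow> 2 * \<eta> \<le> \<mu> + g'" "g' \<noteq> \<mu> \<Longrightarrow> 2 * \<eta> \<le> \<mu> - g'" "s \<noteq> 0 \<Longrightarrow> 2 * \<eta> \<le> \<bar>s\<bar>"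
    and D: "2 * \<bar>a * (\<mu> + g)\<bar> \<le> D" "2 * \<bar>b * (\<mu> - g)\<bar> \<le> D"
begin

private lemma square_le:
  assumes "2 * \<bar>u * v\<bar> \<le> D" "\<eta> \<le> v"
  shows "u\<^sup>2 \<le> (D / (2 * \<eta>))\<^sup>2"
proof -
  have "2 * (\<bar>u\<bar> * \<eta>) \<le> 2 * (\<bar>u\<bar> * \<bar>v\<bar>)"
    using assms \<eta> by (simp add: mult_left_mono)
  then have "\<bar>u\<bar> \<le> D / (2 * \<eta>)"
    using assms \<eta> by (simp add: abs_mult field_simps)
  then show ?thesis
    by (metis abs_ge_zero power2_abs power_mono)
qed

text \<open>A gap of \<open>2 * \<eta>\<close> minus a perturbation of \<open>\<eta>\<close> leaves
  \<open>\<mu> + g >= \<eta>\<close>, so the gradient bound controls \<open>a\<close>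
  itself.\<close>

lemma a_square_le: "g' \<noteq> - \<mu> \<Longrightarrow> a\<^sup>2 \<le> (D / (2 * \<eta>))\<^sup>2"
  using gap(1) near(1) by (intro square_le[OF D(1)]) linarith

lemma b_square_le: "g' \<noteq> \<mu> \<Longrightarrow> b\<^sup>2 \<le> (D / (2 * \<eta>))\<^sup>2"
  using gap(2) near(1) by (intro square_le[OF D(2)]) linarith

lemma min_square_le: "min (a\<^sup>2) (b\<^sup>2) \<le> (D / (2 * \<eta>))\<^sup>2"
  using a_square_le b_square_le \<eta> by (cases "g' = \<mu>") auto

text \<open>Where clipping cuts off the negative part of \<open>x\<close>, the loss is at most
  \<open>b^2\<close>, and there \<open>g' \<noteq> \<mu>\<close>; cutting off the positive part
  costs at most \<open>a^2\<close>, and there \<open>g' \<noteq> - \<mu>\<close>. Each square is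
  bounded exactly where it is needed.\<close>

lemma cone_clip_error: "\<bar>x - cone_clip \<mu> g' s x\<bar> \<le> (D / (2 * \<eta>))\<^sup>2"
proof -
  have "\<bar>A - B - cone_clip \<mu> g' s (A - B)\<bar> \<le> E"
    if "0 \<le> A" "0 \<le> B" "0 \<le> E" "g' \<noteq> - \<mu> \<Longrightarrow> A \<le> E" "g' \<noteq> \<mu> \<Longrightarrow> B \<le> E" for A B E
    using that \<eta> by (auto simp: cone_clip_def max_def min_def)
  then show ?thesis
    using a_square_le b_square_le unfolding x by simp
qed

text \<open>One summand of the convexity bound for \<open>f x - f p\<close>. When the signs of
  \<open>x\<close> and \<open>p\<close> agree, it collapses to \<open>(\<mu> + g) * (x - p)\<close>
  or \<open>(\<mu> - g) * (p - x)\<close>; its first factor is controlled with the help of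
  \<open>a\<close> or \<open>b\<close>. If clipping yields 0, then \<open>p = 0\<close> and
  \<open>x\<close> is of order \<open>D^2\<close>.\<close>

lemma gap_term_le:
  assumes p: "g' * p + \<mu> * \<bar>p\<bar> = 0" "s = 0 \<Longrightarrow> \<bar>g'\<bar> = \<mu> \<Longrightarrow> \<bar>p\<bar> \<le> \<bar>cone_clip \<mu> g' s x\<bar>"
    and R: "\<bar>cone_clip \<mu> g' s x - p\<bar> \<le> R" "R \<le> 1"
  shows "g * (x - p) + \<mu> * (\<bar>x\<bar> - \<bar>p\<bar>) \<le> (1 + 1 / sqrt \<eta>) * D * sqrt R + 3 * \<mu> * (D / (2 * \<eta>))\<^sup>2"
proof -
  let ?E = "3 * \<mu> * (D / (2 * \<eta>))\<^sup>2"
  have "0 \<le> D" "0 \<le> R" using D(1) R(1) by linarith+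
  have "0 < \<mu>" using \<eta> by linarith
  have g: "\<bar>g\<bar> \<le> 2 * \<mu>" using near(1) crit(1) \<eta> by linarith
  have E: "0 \<le> ?E" using \<open>0 < \<mu>\<close> by simp
  have D1: "0 \<le> D * sqrt R" and D2: "0 \<le> 1 / sqrt \<eta> * D * sqrt R"
    using \<open>0 \<le> D\<close> \<open>0 \<le> R\<close> \<eta> by simp_all
  \<comment> \<open>\<open>\<bar>y\<bar>\<close> is split into two square roots: one is at most
    \<open>\<bar>u\<bar>\<close> and completes \<open>v\<close> to \<open>u * v\<close>, the other
    is at most \<open>sqrt R\<close>.\<close>
  have aux: "v * y \<le> D * sqrt R" if "2 * \<bar>u * v\<bar> \<le> D" "\<bar>y\<bar> \<le> R" "\<bar>y\<bar> \<le> u\<^sup>2" for u v y :: real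
  proof -
    have "v * y \<le> \<bar>v\<bar> * (sqrt \<bar>y\<bar> * sqrt \<bar>y\<bar>)"
      by (simp add: abs_mult[symmetric])
    also have "\<dots> \<le> \<bar>v\<bar> * (\<bar>u\<bar> * sqrt R)"
      using that(2,3) by (intro mult_left_mono mult_mono real_le_lsqrt) auto
    also have "\<dots> = \<bar>u * v\<bar> * sqrt R"
      by (simp add: abs_mult)
    also have "\<dots> \<le> D * sqrt R"
      using that(1) \<open>0 \<le> R\<close> by (intro mult_right_mono) auto
    finally show ?thesis .
  qed
  \<comment> \<open>Here \<open>u\<close> is bounded away from zero, so \<open>v\<close> itself is
    of order \<open>D\<close>; \<open>R <= 1\<close> allows the linear factor to be weakened to
    \<open>sqrt R\<close>.\<close>
  have aux': "v * y \<le> 1 / sqrt \<eta> * D * sqrt R" if "2 * \<bar>u * v\<bar> \<le> D" "\<bar>y\<bar> \<le> R" "\<eta> \<le> u\<^sup>2" for u v y :: real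
  proof -
    have "R \<le> sqrt R"
      using R(2) \<open>0 \<le> R\<close> by (intro real_le_rsqrt) (simp add: power2_eq_square mult_left_le)
    have "sqrt \<eta> \<le> \<bar>u\<bar>"
      using that(3) real_sqrt_le_mono by fastforce
    then have "sqrt \<eta> * \<bar>v\<bar> \<le> \<bar>u * v\<bar>"
      by (simp add: abs_mult mult_right_mono)
    then have "sqrt \<eta> * \<bar>v\<bar> \<le> D"
      using that(1) by linarith
    then have "\<bar>v\<bar> \<le> D / sqrt \<eta>"
      using \<eta> by (simp add: field_simps)
    have "v * y \<le> \<bar>v\<bar> * \<bar>y\<bar>"
      by (simp add: abs_mult[symmetric])
    also have "\<dots> \<le> D / sqrt \<eta> * sqrt R"
      using \<open>\<bar>v\<bar> \<le> D / sqrt \<eta>\<close> \<open>R \<le> sqrt R\<close> that(2) by (intro mult_mono) auto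
    finally show ?thesis by simp
  qed
  have small: "g * x + \<mu> * \<bar>x\<bar> \<le> ?E" if "cone_clip \<mu> g' s x = 0"
  proof -
    have "g * x \<le> \<bar>g\<bar> * \<bar>x\<bar>"
      by (simp add: abs_mult[symmetric])
    also have "\<dots> \<le> 2 * \<mu> * \<bar>x\<bar>"
      using g by (intro mult_right_mono) auto
    finally have "g * x + \<mu> * \<bar>x\<bar> \<le> 3 * \<mu> * \<bar>x\<bar>" by simp
    also have "\<dots> \<le> ?E"
      using cone_clip_error \<open>0 < \<mu>\<close> unfolding that by (intro mult_left_mono) auto
    finally show ?thesis .
  qed
  have main: "g * (x - p) + \<mu> * (\<bar>x\<bar> - \<bar>p\<bar>)
      \<le> max (D * sqrt R) (max (1 / sqrt \<eta> * D * sqrt R) ?E)"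
  proof (cases "s = 0")
    case False
    then have tr: "cone_clip \<mu> g' s x = x" by (simp add: cone_clip_def)
    consider "0 < s" | "s < 0" using False by linarith
    then show ?thesis
    proof cases
      case 1
      \<comment> \<open>Complementarity at \<open>s\<close> puts \<open>g'\<close> on the boundary,
        and complementarity at \<open>p\<close> then fixes the sign of \<open>p\<close>.\<close>
      have "(g' + \<mu>) * s = 0" using crit(2) 1 by (simp add: algebra_simps)
      then have "g' = - \<mu>" using 1 by simp
      then have "\<mu> * (\<bar>p\<bar> - p) = 0" using p(1) by (simp add: algebra_simps)
      then have "\<bar>p\<bar> = p" using \<open>0 < \<mu>\<close> by simp
      moreover have "\<eta> \<le> x" using gap(3)[OF False] near(2) 1 by linarith
      then have "\<bar>x\<bar> = x" "\<eta> \<le> a\<^sup>2" using \<eta> x by auto (smt (verit) zero_le_power2)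
      ultimately show ?thesis
        using aux'[OF D(1), of "x - p"] R(1) unfolding tr by (auto simp: algebra_simps)
    next
      case 2
      have "(g' - \<mu>) * s = 0" using crit(2) 2 by (simp add: algebra_simps)
      then have "g' = \<mu>" using 2 by simp
      then have "\<mu> * (\<bar>p\<bar> + p) = 0" using p(1) by (simp add: algebra_simps)
      then have "\<bar>p\<bar> = - p" using \<open>0 < \<mu>\<close> by simp
      moreover have "\<eta> \<le> - x" using gap(3)[OF False] near(2) 2 by linarith
      then have "\<bar>x\<bar> = - x" "\<eta> \<le> b\<^sup>2" using \<eta> x by auto (smt (verit) zero_le_power2)
      ultimately show ?thesis
        using aux'[OF D(2), of "p - x"] R(1) abs_minus_commute[of x p] unfolding tr by (auto simp: algebra_simps)
    qed
  next
    case True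
    consider "g' = - \<mu>" | "g' = \<mu>" | "\<bar>g'\<bar> < \<mu>" using crit(1) by linarith
    then show ?thesis
    proof cases
      case 1
      then have tr: "cone_clip \<mu> g' s x = max x 0" using True by (simp add: cone_clip_def)
      have "\<mu> * (\<bar>p\<bar> - p) = 0" using p(1) 1 by (simp add: algebra_simps)
      then have "\<bar>p\<bar> = p" using \<open>0 < \<mu>\<close> by simp
      have px: "\<bar>p\<bar> \<le> max x 0" using p(2) True 1 \<open>0 < \<mu>\<close> unfolding tr by auto
      show ?thesis
      proof (cases "0 \<le> x")
        case True
        \<comment> \<open>\<open>p\<close> lies between 0 and \<open>x\<close>, so
          \<open>\<bar>x - p\<bar> <= x <= a^2\<close>; this domination is what \<open>aux\<close>
          requires.\<close>
        then have "\<bar>x - p\<bar> \<le> a\<^sup>2" using px \<open>\<bar>p\<bar> = p\<close> x zero_le_power2[of b] by linarith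
        then show ?thesis
          using aux[OF D(1), of "x - p"] R(1) True \<open>\<bar>p\<bar> = p\<close> unfolding tr by (auto simp: algebra_simps)
      next
        case False
        then have "p = 0" using px by simp
        then show ?thesis using small False tr by auto
      qed
    next
      case 2
      then have tr: "cone_clip \<mu> g' s x = min x 0" using True \<open>0 < \<mu>\<close> by (simp add: cone_clip_def)
      have "\<mu> * (\<bar>p\<bar> + p) = 0" using p(1) 2 by (simp add: algebra_simps)
      then have "\<bar>p\<bar> = - p" using \<open>0 < \<mu>\<close> by simp
      have px: "\<bar>p\<bar> \<le> - min x 0" using p(2) True 2 \<open>0 < \<mu>\<close> unfolding tr by auto
      show ?thesis
      proof (cases "x \<le> 0")
        case True
        then have "\<bar>p - x\<bar> \<le> b\<^sup>2" using px \<open>\<bar>p\<bar> = - p\<close> x zero_le_power2[of a] by linarith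
        then show ?thesis
          using aux[OF D(2), of "p - x"] R(1) abs_minus_commute[of x p] True \<open>\<bar>p\<bar> = - p\<close> unfolding tr
          by (auto simp: algebra_simps min_def split: if_splits)
      next
        case False
        then have "p = 0" using px by simp
        then show ?thesis using small False tr by auto
      qed
    next
      case 3
      have "\<bar>g'\<bar> * \<bar>p\<bar> = \<mu> * \<bar>p\<bar>"
        using p(1) \<open>0 < \<mu>\<close> by (metis abs_minus_cancel abs_mult abs_of_pos abs_abs eq_neg_iff_add_eq_0)
      then have "p = 0" using 3 by auto
      moreover have "cone_clip \<mu> g' s x = 0" using 3 True by (auto simp: cone_clip_def)
      ultimately show ?thesis using small by auto
    qed
  qed
  also have "\<dots> \<le> D * sqrt R + (1 / sqrt \<eta> * D * sqrt R + ?E)"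
    using D1 D2 E by (intro max.boundedI) linarith+
  also have "\<dots> = (1 + 1 / sqrt \<eta>) * D * sqrt R + ?E"
    by (simp add: algebra_simps)
  finally show ?thesis .
qed

end

lemma cone_clip_dist_le: "\<bar>cone_clip \<mu> g s x - s\<bar> \<le> \<bar>x - s\<bar>"
  by (auto simp: cone_clip_def)

text \<open>The coordinatewise form of membership in the normal cone. For
  \<open>s \<noteq> 0\<close> the subgradient \<open>v\<close> is the sign of \<open>s\<close>, and
  the second factor vanishes; for \<open>s = 0\<close> the increments \<open>max x 0\<close> and
  \<open>min x 0\<close> give the sign.\<close>

lemma cone_clip_normal:
  assumes v: "\<And>d. v * d \<le> \<bar>s + d\<bar> - \<bar>s\<bar>" and "g * s + \<mu> * \<bar>s\<bar> = 0" and "0 < \<mu>"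
  shows "(cone_clip \<mu> g s x - s) * (\<mu> * v + g) \<le> 0"
proof (cases "s = 0")
  case False
  have "v * s = \<bar>s\<bar>"
    using v[of s] v[of "- s"] by simp
  then have "(\<mu> * v + g) * s = 0"
    using assms(2) by (simp add: algebra_simps)
  then show ?thesis using False by simp
next
  case True
  have "\<mu> * (v * d) \<le> \<mu> * \<bar>d\<bar>" for d
    using v[of d] True \<open>0 < \<mu>\<close> by simp
  from this[of "max x 0"] this[of "min x 0"] show ?thesis
    using True by (auto simp: cone_clip_def algebra_simps)
qed

section \<open>The lifted objective\<close>

definition square_diff :: "(real ^ 'n) \<times> (real ^ 'n) \<Rightarrow> real ^ 'n" where
  "square_diff z = vec_square (fst z) - vec_square (snd z)"

definition square_diff_deriv ::
    "(real ^ 'n) \<times> (real ^ 'n) \<Rightarrow> (real ^ 'n) \<times> (real ^ 'n) \<Rightarrow> real ^ 'n" where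
  "square_diff_deriv z d = (\<chi> i. 2 * (fst z $ i * fst d $ i - snd z $ i * snd d $ i))"

definition lifted :: "(real ^ 'n \<Rightarrow> real) \<Rightarrow> real \<Rightarrow> (real ^ 'n) \<times> (real ^ 'n) \<Rightarrow> real" where
  "lifted h \<mu> z = h (square_diff z) + \<mu> * (\<Sum>i\<in>UNIV. (fst z $ i)\<^sup>2 + (snd z $ i)\<^sup>2)"

definition lifted_gradient ::
    "(real ^ 'n \<Rightarrow> real) \<Rightarrow> real \<Rightarrow> (real ^ 'n) \<times> (real ^ 'n) \<Rightarrow> (real ^ 'n) \<times> (real ^ 'n)" where
  "lifted_gradient h \<mu> z =
    (\<chi> i. 2 * (fst z $ i * (\<mu> + gradient h (square_diff z) $ i)),
     \<chi> i. 2 * (snd z $ i * (\<mu> - gradient h (square_diff z) $ i)))"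

lemma square_diff_nth [simp]: "square_diff z $ i = (fst z $ i)\<^sup>2 - (snd z $ i)\<^sup>2"
  by (simp add: square_diff_def vec_square_def)

lemma has_derivative_vec_nth [derivative_intros]:
  "(f has_derivative f') F \<Longrightarrow> ((\<lambda>x. f x $ i) has_derivative (\<lambda>h. f' h $ i)) F"
  by (rule bounded_linear.has_derivative[OF bounded_linear_vec_nth])

lemma square_diff_has_derivative:
  "(square_diff has_derivative square_diff_deriv z) (at z)"
  unfolding square_diff_deriv_def
  by (rule has_derivative_vecI)
    (auto intro!: derivative_eq_intros simp: algebra_simps)

lemma lifted_GDERIV:
  assumes "C2 h"
  shows "GDERIV (lifted h \<mu>) z :> lifted_gradient h \<mu> z"
proof -
  have "((\<lambda>z. h (square_diff z)) has_derivative
      (\<lambda>d. square_diff_deriv z d \<bullet> gradient h (square_diff z))) (at z)"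
    using C2_GDERIV[OF assms, of "square_diff z"] unfolding gderiv_def
    by (rule has_derivative_compose[OF square_diff_has_derivative])
  then have "(lifted h \<mu> has_derivative (\<lambda>d. square_diff_deriv z d \<bullet> gradient h (square_diff z)
      + \<mu> * (\<Sum>i\<in>UNIV. 2 * (fst z $ i * fst d $ i) + 2 * (snd z $ i * snd d $ i)))) (at z)"
    unfolding lifted_def by (auto intro!: derivative_eq_intros simp: ac_simps)
  moreover have "square_diff_deriv z d \<bullet> gradient h (square_diff z)
      + \<mu> * (\<Sum>i\<in>UNIV. 2 * (fst z $ i * fst d $ i) + 2 * (snd z $ i * snd d $ i))
      = d \<bullet> lifted_gradient h \<mu> z" for d
    by (simp add: square_diff_deriv_def lifted_gradient_def inner_prod_def inner_vec_def
        sum_distrib_left sum.distrib[symmetric] algebra_simps)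
  ultimately show ?thesis
    by (simp add: gderiv_def)
qed

section \<open>Second-order information on the lifted objective\<close>

lemma lifted_gradient_has_derivative:
  assumes "(gradient h has_derivative H) (at (square_diff z))"
  shows "(lifted_gradient h \<mu> has_derivative (\<lambda>d.
      (\<chi> i. 2 * (fst d $ i * (\<mu> + gradient h (square_diff z) $ i)
          + fst z $ i * H (square_diff_deriv z d) $ i),
       \<chi> i. 2 * (snd d $ i * (\<mu> - gradient h (square_diff z) $ i)
          - snd z $ i * H (square_diff_deriv z d) $ i)))) (at z)"
proof -
  have *: "((\<lambda>z. gradient h (square_diff z)) has_derivative
      (\<lambda>d. H (square_diff_deriv z d))) (at z)"
    by (rule has_derivative_compose[OF square_diff_has_derivative assms])
  show ?thesis
    unfolding lifted_gradient_def
    by (rule has_derivative_Pair; rule has_derivative_vecI)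
      (auto intro!: derivative_eq_intros * simp: algebra_simps)
qed

lemma isCont_lifted_gradient:
  assumes "C2 h"
  shows "isCont (lifted_gradient h \<mu>) z"
proof -
  obtain H where "(gradient h has_derivative H) (at (square_diff z))"
    using C2_gradient_differentiable[OF assms] by (auto simp: differentiable_def)
  then show ?thesis
    using lifted_gradient_has_derivative has_derivative_continuous by blast
qed

text \<open>The last claim uses curvature only where the first-order condition is silent: if
  \<open>fst z $ i = 0\<close>, the direction \<open>axis i 1\<close> in the first block removes the
  term with \<open>H\<close> and leaves \<open>2 * (\<mu> + g_i)\<close>, with \<open>g_i\<close>
  the gradient coordinate. The second block is symmetric.\<close>

lemma lifted_second_order_stationary:
  assumes "C2 h" and so: "second_order_stationary (lifted h \<mu>) z"
  shows "fst z $ i * (\<mu> + gradient h (square_diff z) $ i) = 0" (is ?A)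
    and "snd z $ i * (\<mu> - gradient h (square_diff z) $ i) = 0" (is ?B)
    and "0 < \<mu> \<Longrightarrow> \<bar>gradient h (square_diff z) $ i\<bar> \<le> \<mu>"
proof -
  let ?g = "gradient h (square_diff z)"
  have grad: "gradient (lifted h \<mu>) = lifted_gradient h \<mu>"
    using lifted_GDERIV[OF \<open>C2 h\<close>] by (intro ext gradient_eqI)
  have "lifted_gradient h \<mu> z = 0"
    using so by (simp add: second_order_stationary_def grad)
  then show A: ?A and B: ?B
    by (auto simp: lifted_gradient_def vec_eq_iff zero_prod_def)
  obtain H where H: "(gradient h has_derivative H) (at (square_diff z))"
    using C2_gradient_differentiable[OF \<open>C2 h\<close>] by (auto simp: differentiable_def)
  have hess: "hessian (lifted h \<mu>) z = (\<lambda>d.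
      (\<chi> i. 2 * (fst d $ i * (\<mu> + ?g $ i) + fst z $ i * H (square_diff_deriv z d) $ i),
       \<chi> i. 2 * (snd d $ i * (\<mu> - ?g $ i) - snd z $ i * H (square_diff_deriv z d) $ i)))"
    unfolding hessian_def grad
    by (rule frechet_derivative_at[OF lifted_gradient_has_derivative[OF H], symmetric])
  have psd: "0 \<le> v \<bullet> hessian (lifted h \<mu>) z v" for v
    using so unfolding second_order_stationary_def by blast
  assume "0 < \<mu>"
  have "0 \<le> \<mu> + ?g $ i"
  proof (cases "fst z $ i = 0")
    case True
    then show ?thesis
      using psd[of "(axis i 1, 0)"] by (simp add: hess inner_prod_def inner_axis')
  qed (use A in simp)
  moreover have "0 \<le> \<mu> - ?g $ i"
  proof (cases "snd z $ i = 0")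
    case True
    then show ?thesis
      using psd[of "(0, axis i 1)"] by (simp add: hess inner_prod_def inner_axis')
  qed (use B in simp)
  ultimately show "\<bar>?g $ i\<bar> \<le> \<mu>" by linarith
qed

lemma lifted_eq:
  "lifted h \<mu> z = h (square_diff z) + \<mu> * l1_norm (square_diff z)
    + 2 * \<mu> * (\<Sum>i\<in>UNIV. min ((fst z $ i)\<^sup>2) ((snd z $ i)\<^sup>2))"
proof -
  have "(fst z $ i)\<^sup>2 + (snd z $ i)\<^sup>2
      = \<bar>square_diff z $ i\<bar> + 2 * min ((fst z $ i)\<^sup>2) ((snd z $ i)\<^sup>2)" for i
    by (auto simp: min_def)
  then show ?thesis
    by (simp add: lifted_def l1_norm_def sum.distrib sum_distrib_left[symmetric] distrib_left
        del: square_diff_nth)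
qed

text \<open>The l1-terms stay inside the sum next to the linear terms, so that each coordinate can
  be estimated separately and cancellation of signs is not lost.\<close>

lemma convex_l1_regularized_ge:
  assumes "C2 h" "convex_on UNIV h"
  shows "(\<Sum>i\<in>UNIV. gradient h y $ i * (x $ i - y $ i) + \<mu> * (\<bar>x $ i\<bar> - \<bar>y $ i\<bar>))
    \<le> (h x + \<mu> * l1_norm x) - (h y + \<mu> * l1_norm y)"
  using convex_on_gradient_le[OF assms(2) C2_GDERIV[OF assms(1)], of y x]
  by (simp add: l1_norm_def inner_vec_def sum.distrib sum_distrib_left[symmetric]
      sum_subtractf right_diff_distrib)

section \<open>The KL inequality for the lifted objective\<close>

text \<open>The KL inequality in real arithmetic, before subdifferentials enter. The cap 1 on the
  gap provides \<open>T <= 1\<close> for \<open>powr_le_of_gap_bound\<close>.\<close>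

lemma lifted_KL_inequality:
  fixes h :: "real ^ 'n \<Rightarrow> real" and z0 :: "(real ^ 'n) \<times> (real ^ 'n)"
  assumes C2: "C2 h" and conv: "convex_on UNIV h" and \<mu>: "0 < \<mu>"
    and f: "f = (\<lambda>x. h x + \<mu> * l1_norm x)"
    and so: "second_order_stationary (lifted h \<mu>) z0"
    and s: "s = square_diff z0"
    and \<Omega>: "\<Omega> = {x. f x = f s}"
    and K: "K = normal_cone ((\<lambda>v. \<mu> *\<^sub>R v) ` convex_subdifferential l1_norm s) (- gradient h s)"
    and S: "S = (\<lambda>\<rho>. {x. \<forall>i. s $ i = 0 \<and> \<bar>gradient h s $ i\<bar> = \<mu> \<longrightarrow> \<bar>x $ i - s $ i\<bar> \<le> \<rho> i})"
    and V: "s \<in> interior V" and c: "0 < c" and \<gamma>: "0 < \<gamma>" "\<gamma> \<le> 1"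
    and error_bound: "\<And>\<rho> x. (\<And>i. 0 \<le> \<rho> i) \<Longrightarrow> x \<in> V \<Longrightarrow> x - s \<in> K \<Longrightarrow>
           infdist x (\<Omega> \<inter> S \<rho>) \<le> c * max (infdist x \<Omega>) (infdist x (S \<rho>)) powr \<gamma>"
    and KL: "KL_property (\<lambda>x. ereal (f x)) s \<alpha>"
    and \<beta>: "\<beta> = 1 - \<gamma> * (1 - \<alpha>)"
  obtains C U where "0 < C" "z0 \<in> interior U"
    "\<And>z. z \<in> U \<Longrightarrow> lifted h \<mu> z0 < lifted h \<mu> z \<Longrightarrow> lifted h \<mu> z < lifted h \<mu> z0 + 1 \<Longrightarrow>
      (lifted h \<mu> z - lifted h \<mu> z0) powr ((1 + \<beta>) / 2) \<le> C * norm (lifted_gradient h \<mu> z)"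
proof -
  define G where "G = gradient h s"
  have stat_a: "fst z0 $ i * (\<mu> + G $ i) = 0" and stat_b: "snd z0 $ i * (\<mu> - G $ i) = 0"
    and G_le: "\<bar>G $ i\<bar> \<le> \<mu>" for i
    using lifted_second_order_stationary[OF C2 so] \<mu> by (simp_all add: G_def s)
  \<comment> \<open>The factors \<open>\<mu> + G $ i\<close> and \<open>\<mu> - G $ i\<close> add up
    to \<open>2 * \<mu>\<close> and cannot both vanish.\<close>
  have disj: "fst z0 $ i = 0 \<or> snd z0 $ i = 0" for i
    using stat_a[of i] stat_b[of i] \<mu> by auto
  have crit: "G $ i * s $ i + \<mu> * \<bar>s $ i\<bar> = 0" for i
  proof -
    consider "fst z0 $ i = 0" "G $ i = \<mu>" | "snd z0 $ i = 0" "G $ i = - \<mu>"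
      | "fst z0 $ i = 0" "snd z0 $ i = 0"
      using stat_a[of i] stat_b[of i] disj[of i] by auto
    then show ?thesis by cases (simp_all add: s)
  qed
  have "min ((fst z0 $ i)\<^sup>2) ((snd z0 $ i)\<^sup>2) = 0" for i
    using disj[of i] by auto
  then have F0: "lifted h \<mu> z0 = f s"
    by (simp add: lifted_eq f s)
  have gap_ge: "(\<Sum>i\<in>UNIV. gradient h y $ i * (x $ i - y $ i) + \<mu> * (\<bar>x $ i\<bar> - \<bar>y $ i\<bar>)) \<le> f x - f y" for x y
    unfolding f by (rule convex_l1_regularized_ge[OF C2 conv])
  have G_ge: "0 \<le> G $ i * x $ i + \<mu> * \<bar>x $ i\<bar>" for x i
    using mult_right_mono[OF G_le, of "\<bar>x $ i\<bar>" i] abs_ge_minus_self[of "G $ i * x $ i"]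
    by (simp add: abs_mult)
  \<comment> \<open>By \<open>crit\<close> the terms belonging to \<open>s\<close> cancel, leaving
    summands that are nonnegative by \<open>G_ge\<close>. Hence \<open>s\<close> is a global
    minimizer, and on \<open>\<Omega>\<close> every summand vanishes.\<close>
  have sum_G: "(\<Sum>i\<in>UNIV. G $ i * x $ i + \<mu> * \<bar>x $ i\<bar>) \<le> f x - f s" for x
  proof -
    have "G $ i * x $ i + \<mu> * \<bar>x $ i\<bar> = G $ i * (x $ i - s $ i) + \<mu> * (\<bar>x $ i\<bar> - \<bar>s $ i\<bar>)" for i
      using crit[of i] by (simp add: algebra_simps)
    then show ?thesis
      using gap_ge[of s x] by (simp add: G_def)
  qed
  have f_min: "f s \<le> f x" for x
    using sum_G[of x] sum_nonneg[of UNIV "\<lambda>i. G $ i * x $ i + \<mu> * \<bar>x $ i\<bar>"] G_ge[where x = x] by force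
  have G_\<Omega>: "G $ i * x $ i + \<mu> * \<bar>x $ i\<bar> = 0" if "x \<in> \<Omega>" for x i
  proof -
    have "(\<Sum>i\<in>UNIV. G $ i * x $ i + \<mu> * \<bar>x $ i\<bar>) = 0"
      using sum_G[of x] that G_ge[where x = x] by (intro antisym sum_nonneg) (auto simp: \<Omega>)
    then show ?thesis
      using sum_nonneg_eq_0_iff[of UNIV "\<lambda>i. G $ i * x $ i + \<mu> * \<bar>x $ i\<bar>"] G_ge[where x = x] by simp
  qed
  have cont_h: "continuous_on UNIV h"
    using C2_GDERIV[OF C2] unfolding gderiv_def
    by (intro continuous_at_imp_continuous_on ballI has_derivative_continuous) blast
  have cont_f: "continuous_on UNIV f"
    unfolding f l1_norm_def by (intro continuous_intros cont_h)
  obtain C1 d where C1: "0 < C1" and d: "0 < d"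
    and growth: "\<And>x. x \<in> ball s d \<Longrightarrow> infdist x {y. f y = f s} \<le> C1 * (f x - f s) powr (1 - \<alpha>)"
    using KL_property_imp_error_bound[OF cont_f f_min KL] by blast
  \<comment> \<open>All distances of \<open>G $ i\<close> from the two boundary values and of
    \<open>s $ i\<close> from 0 share one gap; the entry \<open>\<mu>\<close> yields
    \<open>\<eta> <= \<mu>\<close>.\<close>
  let ?A = "insert \<mu> (range (\<lambda>i. \<mu> + G $ i) \<union> range (\<lambda>i. \<mu> - G $ i) \<union> range (\<lambda>i. \<bar>s $ i\<bar>))"
  obtain \<eta> where \<eta>_pos: "0 < \<eta>" and \<eta>_le: "\<And>x. x \<in> ?A \<Longrightarrow> 0 < x \<Longrightarrow> 2 * \<eta> \<le> x"
    by (rule finite_positive_lower_bound[of ?A])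
      auto
  have \<eta>: "0 < \<eta>" "\<eta> \<le> \<mu>"
    using \<eta>_pos \<eta>_le[of \<mu>] \<mu> by auto
  have gap: "G $ i \<noteq> - \<mu> \<Longrightarrow> 2 * \<eta> \<le> \<mu> + G $ i" "G $ i \<noteq> \<mu> \<Longrightarrow> 2 * \<eta> \<le> \<mu> - G $ i"
      "s $ i \<noteq> 0 \<Longrightarrow> 2 * \<eta> \<le> \<bar>s $ i\<bar>" for i
    using \<eta>_le[of "\<mu> + G $ i"] \<eta>_le[of "\<mu> - G $ i"] \<eta>_le[of "\<bar>s $ i\<bar>"] G_le[of i]
    by auto
  have "isCont (gradient h) s"
    using C2_gradient_differentiable[OF C2] differentiable_imp_continuous_within by blast
  then have "\<forall>\<^sub>F y in nhds s. dist (gradient h y) G < \<eta>"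
    unfolding G_def using \<eta>(1) by (rule eventually_nhds_isCont_dist)
  moreover have "\<forall>\<^sub>F y in nhds s. y \<in> V"
    using V by (auto simp: eventually_nhds interior_def)
  ultimately have "\<forall>\<^sub>F y in nhds s. dist (gradient h y) G < \<eta> \<and> y \<in> V"
    by (rule eventually_conj)
  then obtain d' where d': "0 < d'"
    and near: "\<And>y. dist y s < d' \<Longrightarrow> dist (gradient h y) G < \<eta> \<and> y \<in> V"
    by (auto simp: eventually_nhds_metric)
  \<comment> \<open>\<open>d\<close> serves the error bound from KL, \<open>d'\<close> the gradient
    estimate and \<open>V\<close>, \<open>\<eta>\<close> the coordinates of \<open>x\<close>, and 1
    the requirement \<open>R <= 1\<close> of \<open>gap_term_le\<close>.\<close>
  define \<delta> where "\<delta> = Min {d, d', \<eta>, 1}"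
  have \<delta>: "0 < \<delta>" "\<delta> \<le> d" "\<delta> \<le> d'" "\<delta> \<le> \<eta>" "\<delta> \<le> 1"
    using d d' \<eta> by (auto simp: \<delta>_def)

  define N where "N = real CARD('n)"
  define q where "q = (1 - \<beta>) / 2"
  have "\<alpha> < 1" "0 \<le> \<alpha>" using KL by (auto simp: KL_property_def)
  have \<beta>01: "0 \<le> \<beta>" "\<beta> \<le> 1"
    using \<gamma> \<open>\<alpha> < 1\<close> \<open>0 \<le> \<alpha>\<close> mult_le_one[of \<gamma> "1 - \<alpha>"] by (auto simp: \<beta>)
  \<comment> \<open>\<open>L\<close> is the root of the constant in the distance bound,
    \<open>M1\<close> collects the mixed terms of all coordinates. In \<open>M2\<close>, the 5 is 3
    from \<open>gap_term_le\<close> plus 2 from the minima, and \<open>4 * \<eta>^2\<close> comes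
    from \<open>E\<close>.\<close>
  define L where "L = sqrt (c * C1 powr \<gamma>)"
  define M1 where "M1 = N * (1 + 1 / sqrt \<eta>) * L"
  define M2 where "M2 = 5 * \<mu> * N / (4 * \<eta>\<^sup>2)"
  define M where "M = M1 + M2"
  have "0 \<le> N" "0 \<le> L" using c by (auto simp: N_def L_def)
  then have M: "0 \<le> M1" "0 \<le> M2" "0 \<le> M"
    using \<eta> \<mu> by (auto simp: M1_def M2_def M_def)
  define C where "C = 1 + M + M * (1 + M) powr ((1 - \<beta>) / 2)"
  have "0 < C" using M by (simp add: C_def add_pos_nonneg)
  define U where "U = {z. dist (square_diff z) s < \<delta>}"

  have "isCont square_diff z0"
    by (rule has_derivative_continuous[OF square_diff_has_derivative])
  then have "\<forall>\<^sub>F z in nhds z0. dist (square_diff z) s < \<delta>"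
    unfolding s using \<delta>(1) by (rule eventually_nhds_isCont_dist)
  then have U: "z0 \<in> interior U"
    by (auto simp: eventually_nhds interior_def U_def)

  have main: "(lifted h \<mu> z - lifted h \<mu> z0) powr ((1 + \<beta>) / 2) \<le> C * norm (lifted_gradient h \<mu> z)"
    if z: "z \<in> U" and T: "lifted h \<mu> z0 < lifted h \<mu> z" "lifted h \<mu> z < lifted h \<mu> z0 + 1" for z
  proof -
    define x where "x = square_diff z"
    define D where "D = norm (lifted_gradient h \<mu> z)"
    define g where "g = gradient h x"
    define y where "y = (\<chi> i. cone_clip \<mu> (G $ i) (s $ i) (x $ i))"
    define t where "t = f y - f s"
    \<comment> \<open>With these radii \<open>y\<close> lies in \<open>S \<rho>\<close>, so only the
      distance to \<open>\<Omega>\<close> remains in the error bound, and the point \<open>p\<close>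
      found below satisfies \<open>\<bar>p $ i\<bar> <= \<bar>y $ i\<bar>\<close> on the degenerate
      coordinates, where \<open>s $ i = 0\<close>.\<close>
    define \<rho> where "\<rho> i = \<bar>y $ i\<bar>" for i
    have y_nth: "y $ i = cone_clip \<mu> (G $ i) (s $ i) (x $ i)" for i by (simp add: y_def)
    have "0 \<le> D" by (simp add: D_def)
    have x: "dist x s < \<delta>" using z by (simp add: U_def x_def)
    have "norm (y - s) \<le> norm (x - s)"
      by (rule norm_le_componentwise_cart) (simp add: y_nth cone_clip_dist_le)
    then have y: "dist y s < \<delta>" using x by (simp add: dist_norm)
    have xs: "\<bar>x $ i - s $ i\<bar> \<le> \<eta>" for i
      using component_le_norm_cart[of "x - s" i] x \<delta> by (simp add: dist_norm)
    have grad_near: "\<bar>gradient h w $ i - G $ i\<bar> \<le> \<eta>" if "dist w s < \<delta>" for w i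
      using component_le_norm_cart[of "gradient h w - G" i] near[of w] that \<delta> by (simp add: dist_norm)
    have D1: "2 * \<bar>fst z $ i * (\<mu> + g $ i)\<bar> \<le> D" for i
      using component_le_norm_cart[of "fst (lifted_gradient h \<mu> z)" i] norm_fst_le[where x = "fst (lifted_gradient h \<mu> z)" and y = "snd (lifted_gradient h \<mu> z)"]
      by (simp add: lifted_gradient_def D_def g_def x_def abs_mult)
    have D2: "2 * \<bar>snd z $ i * (\<mu> - g $ i)\<bar> \<le> D" for i
      using component_le_norm_cart[of "snd (lifted_gradient h \<mu> z)" i] norm_snd_le[where x = "fst (lifted_gradient h \<mu> z)" and y = "snd (lifted_gradient h \<mu> z)"]
      by (simp add: lifted_gradient_def D_def g_def x_def abs_mult)
    have x_nth: "x $ i = (fst z $ i)\<^sup>2 - (snd z $ i)\<^sup>2" for i by (simp add: x_def)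
    note coord = \<eta> x_nth grad_near[OF x, folded g_def] xs G_le crit gap D1 D2
    define E where "E = (D / (2 * \<eta>))\<^sup>2"
    have E: "5 * \<mu> * N * E = M2 * D\<^sup>2"
      by (simp add: E_def M2_def power_divide power_mult_distrib)
    have "0 \<le> E" by (simp add: E_def)
    have min_le: "min ((fst z $ i)\<^sup>2) ((snd z $ i)\<^sup>2) \<le> E" for i
      unfolding E_def by (rule min_square_le[OF coord])
    have xy: "\<bar>x $ i - y $ i\<bar> \<le> E" for i
      unfolding E_def y_nth by (rule cone_clip_error[OF coord])

    have "y - s \<in> K"
    proof -
      have "(y - s) \<bullet> (\<mu> *\<^sub>R v + G) \<le> 0" if v: "v \<in> convex_subdifferential l1_norm s" for v
        unfolding inner_vec_def
        using cone_clip_normal[OF convex_subdifferential_l1_norm[OF v] crit \<mu>]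
        by (intro sum_nonpos) (simp add: y_nth)
      then show ?thesis by (auto simp: K normal_cone_def G_def)
    qed
    moreover have "y \<in> V" using near y \<delta> by auto
    ultimately have "infdist y (\<Omega> \<inter> S \<rho>) \<le> c * max (infdist y \<Omega>) (infdist y (S \<rho>)) powr \<gamma>"
      by (intro error_bound) (auto simp: \<rho>_def)
    moreover have "y \<in> S \<rho>" by (simp add: S \<rho>_def)
    moreover have "infdist y \<Omega> \<le> C1 * t powr (1 - \<alpha>)"
      using growth[of y] y \<delta> by (simp add: \<Omega> t_def dist_commute)
    ultimately have "infdist y (\<Omega> \<inter> S \<rho>) \<le> c * infdist y \<Omega> powr \<gamma>"
      by (simp add: infdist_nonneg max_absorb1)
    also have "\<dots> \<le> c * (C1 * t powr (1 - \<alpha>)) powr \<gamma>"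
      using \<open>infdist y \<Omega> \<le> _\<close> c \<gamma> by (intro mult_left_mono powr_mono2) (auto simp: infdist_nonneg)
    \<comment> \<open>The composed exponent \<open>\<gamma> * (1 - \<alpha>)\<close> equals
      \<open>1 - \<beta>\<close>.\<close>
    also have "\<dots> = c * C1 powr \<gamma> * t powr (1 - \<beta>)"
      using C1 by (simp add: powr_mult powr_powr \<beta> mult.commute)
    finally have inf_le: "infdist y (\<Omega> \<inter> S \<rho>) \<le> c * C1 powr \<gamma> * t powr (1 - \<beta>)" .
    \<comment> \<open>Membership of \<open>s\<close> keeps the closed intersection nonempty, so the
      distance is attained at some \<open>p\<close>, and it bounds \<open>dist y p\<close> by
      \<open>dist y s < 1\<close>.\<close>
    have s_in: "s \<in> \<Omega> \<inter> S \<rho>" by (simp add: \<Omega> S \<rho>_def)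
    have "closed \<Omega>"
      unfolding \<Omega> by (intro closed_Collect_eq cont_f continuous_intros)
    moreover have "closed (S \<rho>)"
      unfolding S by (intro closed_Collect_all closed_Collect_imp closed_Collect_le open_Collect_const continuous_intros)
    ultimately obtain p where p: "p \<in> \<Omega>" "p \<in> S \<rho>" and R: "infdist y (\<Omega> \<inter> S \<rho>) = dist y p"
      using infdist_attains_inf[of "\<Omega> \<inter> S \<rho>" y] s_in by blast
    have R1: "dist y p \<le> 1"
      using infdist_le[OF s_in, of y] y \<delta> unfolding R by linarith
    have "0 \<le> t" using f_min by (simp add: t_def)
    have sqrtR: "sqrt (dist y p) \<le> L * t powr q"
    proof -
      have "sqrt (t powr (1 - \<beta>)) = t powr q"
        using \<open>0 \<le> t\<close> by (simp add: powr_half_sqrt[symmetric] powr_powr q_def)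
      then show ?thesis
        using real_sqrt_le_mono[OF inf_le[unfolded R]] by (simp add: L_def real_sqrt_mult)
    qed
    have "g $ i * (x $ i - p $ i) + \<mu> * (\<bar>x $ i\<bar> - \<bar>p $ i\<bar>)
        \<le> (1 + 1 / sqrt \<eta>) * D * sqrt (dist y p) + 3 * \<mu> * E" for i
      unfolding E_def
    proof (rule gap_term_le[OF coord])
      show "G $ i * p $ i + \<mu> * \<bar>p $ i\<bar> = 0" by (rule G_\<Omega>[OF p(1)])
      show "\<bar>p $ i\<bar> \<le> \<bar>cone_clip \<mu> (G $ i) (s $ i) (x $ i)\<bar>" if "s $ i = 0" "\<bar>G $ i\<bar> = \<mu>"
        using p(2) that by (auto simp: S \<rho>_def G_def y_nth)
      show "\<bar>cone_clip \<mu> (G $ i) (s $ i) (x $ i) - p $ i\<bar> \<le> dist y p"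
        using component_le_norm_cart[of "y - p" i] by (simp add: dist_norm y_nth)
    qed (assumption | rule R1)+
    then have "(\<Sum>i\<in>UNIV. g $ i * (x $ i - p $ i) + \<mu> * (\<bar>x $ i\<bar> - \<bar>p $ i\<bar>))
        \<le> of_nat CARD('n) * ((1 + 1 / sqrt \<eta>) * D * sqrt (dist y p) + 3 * \<mu> * E)"
      by (intro sum_bounded_above)
    \<comment> \<open>Convexity is used at \<open>x\<close>, whose gradient is the one controlled by
      \<open>D\<close>, with \<open>p\<close> as test point.\<close>
    moreover have "f x - f p \<le> (\<Sum>i\<in>UNIV. g $ i * (x $ i - p $ i) + \<mu> * (\<bar>x $ i\<bar> - \<bar>p $ i\<bar>))"
    proof -
      have "(\<Sum>i\<in>UNIV. g $ i * (x $ i - p $ i) + \<mu> * (\<bar>x $ i\<bar> - \<bar>p $ i\<bar>))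
          = - (\<Sum>i\<in>UNIV. g $ i * (p $ i - x $ i) + \<mu> * (\<bar>p $ i\<bar> - \<bar>x $ i\<bar>))"
        unfolding sum_negf[symmetric] by (intro sum.cong) (auto simp: algebra_simps)
      then show ?thesis
        using gap_ge[of x p] by (simp add: g_def)
    qed
    moreover have "f p = f s" using p(1) by (simp add: \<Omega>)
    ultimately have fx: "f x - f s \<le> N * (1 + 1 / sqrt \<eta>) * D * sqrt (dist y p) + 3 * \<mu> * N * E"
      by (simp add: N_def algebra_simps)
    have "(\<Sum>i\<in>UNIV. min ((fst z $ i)\<^sup>2) ((snd z $ i)\<^sup>2)) \<le> N * E"
      unfolding N_def by (intro sum_bounded_above min_le)
    then have "2 * \<mu> * (\<Sum>i\<in>UNIV. min ((fst z $ i)\<^sup>2) ((snd z $ i)\<^sup>2)) \<le> 2 * \<mu> * (N * E)"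
      using \<mu> by (intro mult_left_mono) auto
    moreover have "N * (1 + 1 / sqrt \<eta>) * D * sqrt (dist y p) \<le> N * (1 + 1 / sqrt \<eta>) * D * (L * t powr q)"
      using sqrtR \<open>0 \<le> N\<close> \<open>0 \<le> D\<close> \<eta> by (intro mult_left_mono) auto
    ultimately have "lifted h \<mu> z - lifted h \<mu> z0 \<le> N * (1 + 1 / sqrt \<eta>) * D * (L * t powr q) + 5 * \<mu> * N * E"
      using fx unfolding F0 by (simp add: lifted_eq f x_def)
    also have "\<dots> = M1 * D * t powr q + M2 * D\<^sup>2"
      unfolding E by (simp add: M1_def)
    also have "\<dots> \<le> M * D * t powr q + M * D\<^sup>2"
      using M \<open>0 \<le> D\<close> by (intro add_mono mult_right_mono) (auto simp: M_def)
    finally have T_le: "lifted h \<mu> z - lifted h \<mu> z0 \<le> M * D * t powr ((1 - \<beta>) / 2) + M * D\<^sup>2"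
      by (simp add: q_def)

    \<comment> \<open>Convexity at \<open>y\<close> shows that truncation raises \<open>f\<close> by
      at most a multiple of \<open>E\<close>, hence of \<open>D^2\<close>.\<close>
    have "gradient h y $ i * (x $ i - y $ i) + \<mu> * (\<bar>x $ i\<bar> - \<bar>y $ i\<bar>) \<ge> - (3 * \<mu> * E)" for i
    proof -
      have "\<bar>gradient h y $ i\<bar> \<le> 2 * \<mu>"
        using grad_near[OF y, of i] G_le[of i] \<eta> by linarith
      then have "\<bar>gradient h y $ i * (x $ i - y $ i)\<bar> \<le> 2 * \<mu> * E"
        unfolding abs_mult using xy[of i] \<mu> by (intro mult_mono) auto
      moreover have "\<mu> * (\<bar>y $ i\<bar> - \<bar>x $ i\<bar>) \<le> \<mu> * E"
        using xy[of i] \<mu> by (intro mult_left_mono) auto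
      ultimately show ?thesis by (simp add: algebra_simps abs_if split: if_splits)
    qed
    then have "of_nat CARD('n) * (- (3 * \<mu> * E))
        \<le> (\<Sum>i\<in>UNIV. gradient h y $ i * (x $ i - y $ i) + \<mu> * (\<bar>x $ i\<bar> - \<bar>y $ i\<bar>))"
      by (intro sum_bounded_below)
    then have "f y - f x \<le> 3 * \<mu> * N * E"
      using gap_ge[of y x] by (simp add: N_def algebra_simps)
    also have "\<dots> \<le> 5 * \<mu> * N * E"
      using \<mu> \<open>0 \<le> N\<close> \<open>0 \<le> E\<close> by (intro mult_right_mono) auto
    also have "\<dots> \<le> M * D\<^sup>2"
      unfolding E using M by (intro mult_right_mono) (auto simp: M_def)
    finally have "f y - f x \<le> M * D\<^sup>2" .
    moreover have "f x \<le> lifted h \<mu> z"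
      using \<mu> by (auto simp: lifted_eq f x_def intro!: mult_nonneg_nonneg sum_nonneg)
    ultimately have t_le: "t \<le> lifted h \<mu> z - lifted h \<mu> z0 + M * D\<^sup>2"
      by (simp add: t_def F0)
    show ?thesis
      unfolding C_def D_def[symmetric]
      by (rule powr_le_of_gap_bound[OF \<open>0 \<le> D\<close> \<open>0 \<le> M\<close> _ _ \<open>0 \<le> t\<close> \<beta>01 t_le T_le]) (use T in auto)
  qed
  show ?thesis
    using that[OF \<open>0 < C\<close> U main] .
qed

section \<open>Translation of the real inequality into the KL property\<close>

theorem theorem3p11:
  fixes h f :: "real ^ 'n \<Rightarrow> real"
    and F :: "(real ^ 'n) \<times> (real ^ 'n) \<Rightarrow> real"
    and \<mu> c \<gamma> \<alpha> \<beta> :: real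
    and a b s :: "real ^ 'n"
    and \<Omega> K V :: "(real ^ 'n) set"
    and S :: "('n \<Rightarrow> real) \<Rightarrow> (real ^ 'n) set"
    and J31 J32 J3 :: "'n set"
  assumes "C2 h" and "convex_on UNIV h" and "0 < \<mu>"
    and f: "f = (\<lambda>x. h x + \<mu> * l1_norm x)"
    and F: "F = (\<lambda>(a, b). h (vec_square a - vec_square b)
                      + \<mu> * (\<Sum>i\<in>UNIV. (a $ i)\<^sup>2 + (b $ i)\<^sup>2))"
    and "second_order_stationary F (a, b)"
    and s: "s = vec_square a - vec_square b"
    and \<Omega>: "\<Omega> = {x. f x = f s}"
    and J31: "J31 = {i. s $ i = 0 \<and> gradient h s $ i = - \<mu>}"
    and J32: "J32 = {i. s $ i = 0 \<and> gradient h s $ i = \<mu>}"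
    and J3: "J3 = J31 \<union> J32"
    and K: "K = normal_cone ((\<lambda>v. \<mu> *\<^sub>R v) ` convex_subdifferential l1_norm s) (- gradient h s)"
    and S: "S = (\<lambda>\<rho>. {x. \<forall>i\<in>J3. \<bar>x $ i - s $ i\<bar> \<le> \<rho> i})"
    and "s \<in> interior V" and "0 < c" and "0 < \<gamma>" and "\<gamma> \<le> 1"
    and error_bound: "\<And>\<rho> x. (\<forall>i\<in>J3. 0 \<le> \<rho> i) \<Longrightarrow> x \<in> V \<inter> (\<lambda>k. s + k) ` K \<Longrightarrow>
           infdist x (\<Omega> \<inter> S \<rho>) \<le> c * max (infdist x \<Omega>) (infdist x (S \<rho>)) powr \<gamma>"
    and "0 < \<alpha>" and "\<alpha> < 1"
    and "KL_property (\<lambda>x. ereal (f x)) s \<alpha>"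
    and \<beta>: "\<beta> = 1 - \<gamma> * (1 - \<alpha>)"
  shows "0 < \<beta> \<and> \<beta> < 1 \<and> KL_property (\<lambda>z. ereal (F z)) (a, b) ((1 + \<beta>) / 2)"
proof -
  have "\<gamma> * (1 - \<alpha>) \<le> 1 - \<alpha>"
    using \<open>\<gamma> \<le> 1\<close> \<open>\<alpha> < 1\<close> by (simp add: mult_left_le_one_le \<open>0 < \<gamma>\<close> less_imp_le)
  then have "0 < \<beta>" using \<open>0 < \<alpha>\<close> by (simp add: \<beta>)
  have "\<beta> < 1" using \<open>0 < \<gamma>\<close> \<open>\<alpha> < 1\<close> by (simp add: \<beta>)
  have F_eq: "F = lifted h \<mu>"
    by (auto simp: F lifted_def square_diff_def)
  have J3_iff: "i \<in> J3 \<longleftrightarrow> s $ i = 0 \<and> \<bar>gradient h s $ i\<bar> = \<mu>" for i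
    using \<open>0 < \<mu>\<close> unfolding J3 J31 J32 by auto
  have S': "S = (\<lambda>\<rho>. {x. \<forall>i. s $ i = 0 \<and> \<bar>gradient h s $ i\<bar> = \<mu> \<longrightarrow> \<bar>x $ i - s $ i\<bar> \<le> \<rho> i})"
    by (simp add: S Ball_def J3_iff)
  have "s = square_diff (a, b)" by (simp add: s square_diff_def)
  then obtain C U where C: "0 < C" and U: "(a, b) \<in> interior U" and ineq:
    "\<And>z. z \<in> U \<Longrightarrow> F (a, b) < F z \<Longrightarrow> F z < F (a, b) + 1 \<Longrightarrow>
      (F z - F (a, b)) powr ((1 + \<beta>) / 2) \<le> C * norm (lifted_gradient h \<mu> z)"
  proof (rule lifted_KL_inequality[OF assms(1-3) f assms(6)[unfolded F_eq] _ \<Omega> K S' assms(14-17)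
        _ \<open>KL_property (\<lambda>x. ereal (f x)) s \<alpha>\<close> \<beta>])
    show "infdist x (\<Omega> \<inter> S \<rho>) \<le> c * max (infdist x \<Omega>) (infdist x (S \<rho>)) powr \<gamma>"
      if "\<And>i. 0 \<le> \<rho> i" "x \<in> V" "x - s \<in> K" for \<rho> x
      using that by (intro error_bound) (auto intro!: image_eqI[of _ _ "x - s"])
  qed (auto simp: F_eq)
  define \<theta> where "\<theta> = (1 + \<beta>) / 2"
  have \<theta>: "0 \<le> \<theta>" "\<theta> < 1" using \<open>0 < \<beta>\<close> \<open>\<beta> < 1\<close> by (auto simp: \<theta>_def)
  have subdiff: "limiting_subdifferential (\<lambda>z. ereal (F z)) z = {lifted_gradient h \<mu> z}" for z
    unfolding F_eq
    by (intro limiting_subdifferential_C1 lifted_GDERIV isCont_lifted_gradient \<open>C2 h\<close>)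
  have "continuous_on UNIV F"
    using lifted_GDERIV[OF \<open>C2 h\<close>] unfolding F_eq gderiv_def
    by (intro continuous_at_imp_continuous_on ballI has_derivative_continuous) blast
  then have "proper_closed (\<lambda>z. ereal (F z))"
    by (rule proper_closed_continuous)
  \<comment> \<open>Dividing \<open>C\<close> by \<open>1 - \<theta>\<close> cancels the factor
    built into \<open>KL_property\<close>; the singleton subdifferential turns
    \<open>dist_zero\<close> into the gradient norm.\<close>
  moreover have "1 \<le> ereal (C / (1 - \<theta>) * (1 - \<theta>) * real_of_ereal (ereal (F z) - ereal (F (a, b))) powr (- \<theta>))
      * dist_zero (limiting_subdifferential (\<lambda>z. ereal (F z)) z)"
    if "z \<in> U" "0 < ereal (F z) - ereal (F (a, b))" "ereal (F z) - ereal (F (a, b)) < 1" for z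
  proof -
    let ?T = "F z - F (a, b)"
    have T: "0 < ?T" "?T < 1" using that(2,3) by (simp_all add: one_ereal_def)
    have "?T powr \<theta> \<le> C * norm (lifted_gradient h \<mu> z)"
      unfolding \<theta>_def using T by (intro ineq \<open>z \<in> U\<close>) auto
    then have "1 \<le> C * ?T powr (- \<theta>) * norm (lifted_gradient h \<mu> z)"
      using T by (simp add: powr_minus field_simps)
    then show ?thesis
      using \<theta> by (simp add: subdiff dist_zero_def one_ereal_def)
  qed
  ultimately have "KL_property (\<lambda>z. ereal (F z)) (a, b) \<theta>"
    unfolding KL_property_def using C U \<theta> subdiff
    by (auto intro!: exI[of _ "C / (1 - \<theta>)"] exI[of _ "1 :: ereal"] exI[of _ U])
  then show ?thesis
    using \<open>0 < \<beta>\<close> \<open>\<beta> < 1\<close> by (simp add: \<theta>_def)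
qed

end
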